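(* Let $A_1,\dots,A_T\in[-1,1]^{d_1\times d_2}$ be any sequence of payoff matrices chosen by an adaptive adversary. Set $\delta=\frac1{T^{1/6}}$ and $\eta=T^{1/6}$, where $T$ is such that $\delta<\min\{\frac1{d_1},\frac1{d_2}\}$, and let $\{(e_{x,t},e_{y,t})\}_{t=1}^T$ be the actions generated by the algorithm Bandit-OMG-RFTL with parameters $\eta,\delta$. Then $$\left|\mathbb{E}\left[\sum_{t=1}^T e_{x,t}^\top A_t e_{y,t}-\min_{x\in\Delta_{d_1}}\max_{y\in\Delta_{d_2}}\sum_{t=1}^T x^\top A_t y\right]\right|\le O\big((d_1+d_2)\ln(T)\,T^{5/6}\big),$$ where the expectation is taken with respect to the randomization in the algorithm.
   Context: $\Delta_d=\{v\in\mathbb{R}^d:\ v\ge0,\ \|v\|_1=1\}$ and $\Delta_{d,\delta}=\{z\in\Delta_d:\ z_i\ge\delta,\ i=1,\dots,d\}$. The constant in $O(\cdot)$ is absolute. Algorithm Bandit-OMG-RFTL with parameters $\eta>0$ and $0<\delta<\min\{1/d_1,1/d_2\}$: let $R_X(x)=\sum_{i=1}^{d_1}x_i\ln x_i+\ln d_1$ and $R_Y(y)=\sum_{i=1}^{d_2}y_i\ln y_i+\ln d_2$. The initial pair $(x_1,y_1)\in\Delta_{d_1,\delta}\times\Delta_{d_2,\delta}$ is arbitrary. In round $t=1,\dots,T$: sample independently (given the past) $i_t\sim x_t$ and $j_t\sim y_t$, and let $e_{x,t}\in\mathbb{R}^{d_1}$, $e_{y,t}\in\mathbb{R}^{d_2}$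 be the standard unit vectors with a 1 in coordinate $i_t$, resp. $j_t$; observe only $e_{x,t}^\top A_te_{y,t}=(A_t)_{i_t,j_t}$; let $\hat A_t$ be the $d_1\times d_2$ matrix whose $(i_t,j_t)$ entry is $\frac{(A_t)_{i_t,j_t}}{x_t(i_t)\,y_t(j_t)}$ and all of whose other entries are $0$; set $\mathcal L_t(x,y)=x^\top\hat A_ty+\frac1\eta R_X(x)-\frac1\eta R_Y(y)$; and $$x_{t+1}=\arg\min_{x\in\Delta_{d_1,\delta}}\max_{y\in\Delta_{d_2,\delta}}\sum_{\tau=1}^t\mathcal L_\tau(x,y),\qquad y_{t+1}=\arg\max_{y\in\Delta_{d_2,\delta}}\min_{x\in\Delta_{d_1,\delta}}\sum_{\tau=1}^t\mathcal L_\tau(x,y).$$ Adaptive adversary: $A_t$ may depend on the players' actions up to round $t-1$, but not on the actions sampled in round $t$. *)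

theory Defs
  imports
    "HOL-Probability.Probability_Mass_Function"
    "Jordan_Normal_Form.Matrix"
begin

(* Both \<open>\<bullet>\<close> and \<open>$\<close> denote the operations on dimension-carrying vectors below. *)
unbundle no inner_syntax and no vec_syntax

definition prob_simplex :: "nat \<Rightarrow> real vec set" where
  "prob_simplex d = {v \<in> carrier_vec d. (\<forall>i<d. 0 \<le> v $ i) \<and> (\<Sum>i<d. \<bar>v $ i\<bar>) = 1}"

definition trunc_simplex :: "nat \<Rightarrow> real \<Rightarrow> real vec set" where
  "trunc_simplex d \<delta> = {z \<in> prob_simplex d. \<forall>i<d. \<delta> \<le> z $ i}"

definition bilin :: "real vec \<Rightarrow> real mat \<Rightarrow> real vec \<Rightarrow> real" where
  "bilin x A y = x \<bullet> (A *\<^sub>v y)"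

(* Minimax over sets: INF and SUP are attained, hence are min and max, for the continuous
   functions and nonempty compact sets to which they are applied. *)
definition minimax :: "'a set \<Rightarrow> 'b set \<Rightarrow> ('a \<Rightarrow> 'b \<Rightarrow> real) \<Rightarrow> real" where
  "minimax X Y f = (INF x\<in>X. SUP y\<in>Y. f x y)"

definition is_argmin_max :: "'a set \<Rightarrow> 'b set \<Rightarrow> ('a \<Rightarrow> 'b \<Rightarrow> real) \<Rightarrow> 'a \<Rightarrow> bool" where
  "is_argmin_max X Y f x \<longleftrightarrow> is_arg_min (\<lambda>x. SUP y\<in>Y. f x y) (\<lambda>x. x \<in> X) x"

definition is_argmax_min :: "'a set \<Rightarrow> 'b set \<Rightarrow> ('a \<Rightarrow> 'b \<Rightarrow> real) \<Rightarrow> 'b \<Rightarrow> bool" where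
  "is_argmax_min X Y f y \<longleftrightarrow> is_arg_max (\<lambda>y. INF x\<in>X. f x y) (\<lambda>y. y \<in> Y) y"

definition neg_entropy :: "nat \<Rightarrow> real vec \<Rightarrow> real" where
  "neg_entropy d x = (\<Sum>i<d. x $ i * ln (x $ i)) + ln (real d)"

definition est_mat :: "nat \<Rightarrow> nat \<Rightarrow> real mat \<Rightarrow> real vec \<Rightarrow> real vec \<Rightarrow> nat \<times> nat \<Rightarrow> real mat" where
  "est_mat d1 d2 A x y = (\<lambda>(i, j).
     mat d1 d2 (\<lambda>(k, l). if k = i \<and> l = j then A $$ (i, j) / (x $ i * y $ j) else 0))"

definition reg_loss :: "real \<Rightarrow> nat \<Rightarrow> nat \<Rightarrow> real mat \<Rightarrow> real vec \<Rightarrow> real vec \<Rightarrow> real" where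
  "reg_loss \<eta> d1 d2 M x y = bilin x M y + 1 / \<eta> * neg_entropy d1 x - 1 / \<eta> * neg_entropy d2 y"

(* A history lists the sampled (0-based) action pairs, oldest first. The round that follows the
   history h has number length h + 1; everything fixed before its sampling step (payoff matrix,
   both iterates) is a function of h. In particular, along a play h, take t h is the history
   preceding the sampled pair h ! t. *)
type_synonym history = "(nat \<times> nat) list"
type_synonym adversary = "history \<Rightarrow> real mat"
type_synonym strategy = "history \<Rightarrow> real vec"

definition histories :: "nat \<Rightarrow> nat \<Rightarrow> nat \<Rightarrow> history set" where
  "histories d1 d2 T = {h. length h < T \<and> set h \<subseteq> {..<d1} \<times> {..<d2}}"

definition bounded_adversary :: "nat \<Rightarrow> nat \<Rightarrow> nat \<Rightarrow> adversary \<Rightarrow> bool" where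
  "bounded_adversary d1 d2 T A \<longleftrightarrow>
     (\<forall>h \<in> histories d1 d2 T. A h \<in> carrier_mat d1 d2 \<and>
        (\<forall>i<d1. \<forall>j<d2. A h $$ (i, j) \<in> {-1..1}))"

definition cum_loss ::
  "real \<Rightarrow> nat \<Rightarrow> nat \<Rightarrow> adversary \<Rightarrow> strategy \<Rightarrow> strategy \<Rightarrow> history \<Rightarrow> real vec \<Rightarrow> real vec \<Rightarrow> real" where
  "cum_loss \<eta> d1 d2 A X Y h x y =
     (\<Sum>t<length h. reg_loss \<eta> d1 d2
        (est_mat d1 d2 (A (take t h)) (X (take t h)) (Y (take t h)) (h ! t)) x y)"

(* X and Y are the iterates of the algorithm run against A; their values at the empty history
   form the arbitrary initial pair. *)
definition bandit_OMG_RFTL ::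
  "real \<Rightarrow> real \<Rightarrow> nat \<Rightarrow> nat \<Rightarrow> nat \<Rightarrow> adversary \<Rightarrow> strategy \<Rightarrow> strategy \<Rightarrow> bool" where
  "bandit_OMG_RFTL \<eta> \<delta> d1 d2 T A X Y \<longleftrightarrow>
     X [] \<in> trunc_simplex d1 \<delta> \<and> Y [] \<in> trunc_simplex d2 \<delta> \<and>
     (\<forall>h \<in> histories d1 d2 T. h \<noteq> [] \<longrightarrow>
        is_argmin_max (trunc_simplex d1 \<delta>) (trunc_simplex d2 \<delta>) (cum_loss \<eta> d1 d2 A X Y h) (X h) \<and>
        is_argmax_min (trunc_simplex d1 \<delta>) (trunc_simplex d2 \<delta>) (cum_loss \<eta> d1 d2 A X Y h) (Y h))"

definition vec_pmf :: "real vec \<Rightarrow> nat pmf" where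
  "vec_pmf v = embed_pmf (\<lambda>i. if i < dim_vec v then v $ i else 0)"

(* Law of the history after t rounds. *)
primrec play_pmf :: "strategy \<Rightarrow> strategy \<Rightarrow> nat \<Rightarrow> history pmf" where
  "play_pmf X Y 0 = return_pmf []"
| "play_pmf X Y (Suc t) =
     bind_pmf (play_pmf X Y t) (\<lambda>h.
       map_pmf (\<lambda>a. h @ [a]) (pair_pmf (vec_pmf (X h)) (vec_pmf (Y h))))"

end

theory Submission
  imports Defs
begin

text \<open>
  The payoff received in round \<open>t\<close> equals the estimated payoff \<open>x\<^sub>t \<bullet> (A'\<^sub>t y\<^sub>t)\<close> of the
  iterates, where \<open>A'\<^sub>t\<close> is the importance-weighted estimate, so everything except the quality
  of the estimates is a pathwise matter. The iterates form a saddle point of the accumulated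
  regularised losses, which are \<open>t / \<eta>\<close>-strongly convex-concave. Quadratic growth at the saddle
  point against the Lipschitz constant \<open>G\<close> of one loss shows that adding the loss of the next
  round changes the minimax value by the loss of the iterates up to \<open>G\<^sup>2 \<eta> / t\<close>; summing gives
  a logarithmic regret. Dropping the regulariser and the truncation costs \<open>(d1 + d2) T / \<eta>\<close> and
  \<open>(d1 + d2) \<delta> T\<close>. Finally each entry of \<open>\<Sum>\<^sub>t (A'\<^sub>t - A\<^sub>t)\<close> is a martingale with second
  moment at most \<open>T / \<delta>\<^sup>2\<close>, and the largest entry bounds the change of the minimax value,
  whatever the adversary does.
\<close>

text \<open>The comparator is a minimax value inside the expectation, and an adaptive adversary lets
  its matrices depend on the sampled actions. Unbiasedness at one fixed pair of strategies therefore
  says nothing about it: the estimates must be controlled uniformly over all strategies. For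
  bilinear payoffs on simplices this reduces to \<open>d1 * d2\<close> entries, and second moments
  suffice because the entries may simply be summed.

  A second obstacle is that the two iterates solve separate problems, min-max and max-min. They form
  a saddle point only once both problems are known to have the same value, so a minimax theorem
  comes first; the strong concavity that drives the regret bound also proves it.

  The parameters balance the errors. With r = T^(1/6), \<delta> = 1/r and \<eta> = r, the Lipschitz
  constant \<open>G\<close> is of order r^2, so G^2 \<eta> is of order r^5, while T/\<eta> and
  \<delta> T both equal r^5. The entry errors are of order sqrt(d1 d2 T)/\<delta>, which is at most
  r^5 because the condition on \<delta> forces d1, d2 < r.\<close>

subsection \<open>Minimax values\<close>

text \<open>Real \<open>INF\<close> and \<open>SUP\<close> are informative only for bounded
  families. One bound uniform in both arguments covers the inner and the outer extrema at
  once.\<close>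

definition bounded_payoff :: "'a set \<Rightarrow> 'b set \<Rightarrow> ('a \<Rightarrow> 'b \<Rightarrow> real) \<Rightarrow> bool" where
  "bounded_payoff X Y f \<longleftrightarrow> (\<exists>B. \<forall>x\<in>X. \<forall>y\<in>Y. \<bar>f x y\<bar> \<le> B)"

lemma bounded_payoffD:
  assumes "bounded_payoff X Y f"
  shows "x \<in> X \<Longrightarrow> bdd_above (f x ` Y)"
    and "y \<in> Y \<Longrightarrow> bdd_below ((\<lambda>x. f x y) ` X)"
    and "Y \<noteq> {} \<Longrightarrow> bdd_below ((\<lambda>x. SUP y\<in>Y. f x y) ` X)"
    and "X \<noteq> {} \<Longrightarrow> bdd_above ((\<lambda>y. INF x\<in>X. f x y) ` Y)"
proof -
  obtain B where B: "\<And>x y. x \<in> X \<Longrightarrow> y \<in> Y \<Longrightarrow> \<bar>f x y\<bar> \<le> B"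
    using assms unfolding bounded_payoff_def by blast
  have up: "f x y \<le> B" and lo: "- B \<le> f x y" if "x \<in> X" "y \<in> Y" for x y
    using B[OF that] by auto
  show above: "bdd_above (f x ` Y)" if "x \<in> X" for x
    using up that by (intro bdd_aboveI2) auto
  show below: "bdd_below ((\<lambda>x. f x y) ` X)" if "y \<in> Y" for y
    using lo that by (intro bdd_belowI2) auto
  show "bdd_below ((\<lambda>x. SUP y\<in>Y. f x y) ` X)" if ne: "Y \<noteq> {}"
  proof (rule bdd_belowI2)
    fix x assume "x \<in> X"
    moreover obtain y where "y \<in> Y" using ne by blast
    ultimately show "- B \<le> (SUP y\<in>Y. f x y)"
      using above lo by (intro cSUP_upper2[where x = y]) auto
  qed
  show "bdd_above ((\<lambda>y. INF x\<in>X. f x y) ` Y)" if ne: "X \<noteq> {}"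
  proof (rule bdd_aboveI2)
    fix y assume "y \<in> Y"
    moreover obtain x where "x \<in> X" using ne by blast
    ultimately show "(INF x\<in>X. f x y) \<le> B"
      using below up by (intro cINF_lower2[where x = x]) auto
  qed
qed

lemma minimax_le:
  assumes "bounded_payoff X Y f" "Y \<noteq> {}" "x \<in> X" "\<And>y. y \<in> Y \<Longrightarrow> f x y \<le> c"
  shows "minimax X Y f \<le> c"
proof -
  have "minimax X Y f \<le> (SUP y\<in>Y. f x y)"
    unfolding minimax_def using assms by (intro cINF_lower bounded_payoffD)
  also have "\<dots> \<le> c" using assms by (intro cSUP_least) auto
  finally show ?thesis .
qed

lemma minimax_ge:
  assumes "bounded_payoff X Y f" "X \<noteq> {}" "y \<in> Y" "\<And>x. x \<in> X \<Longrightarrow> c \<le> f x y"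
  shows "c \<le> minimax X Y f"
  unfolding minimax_def
proof (rule cINF_greatest[OF assms(2)])
  fix x assume "x \<in> X"
  then show "c \<le> (SUP y\<in>Y. f x y)"
    using assms(3,4) bounded_payoffD(1)[OF assms(1)] by (intro cSUP_upper2[where x = y])
qed

text \<open>A simulation argument between two games: the minimiser copies each strategy
  \<open>x'\<close> of the second game into the first, and each reply \<open>y\<close> there is
  translated back into a reply \<open>y'\<close>. Payoffs and strategy sets may both differ, which
  is what removing the truncation requires.\<close>

lemma minimax_mono:
  assumes "bounded_payoff X Y f" "bounded_payoff X' Y' g" "Y \<noteq> {}" "X' \<noteq> {}"
    and "\<And>x'. x' \<in> X' \<Longrightarrow> \<exists>x\<in>X. \<forall>y\<in>Y. \<exists>y'\<in>Y'. f x y \<le> g x' y' + c"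
  shows "minimax X Y f \<le> minimax X' Y' g + c"
proof -
  have "minimax X Y f - c \<le> (SUP y'\<in>Y'. g x' y')" if x': "x' \<in> X'" for x'
  proof -
    obtain x where x: "x \<in> X" "\<And>y. y \<in> Y \<Longrightarrow> \<exists>y'\<in>Y'. f x y \<le> g x' y' + c"
      using assms(5)[OF x'] by blast
    have "f x y \<le> (SUP y'\<in>Y'. g x' y') + c" if y: "y \<in> Y" for y
    proof -
      obtain y' where y': "y' \<in> Y'" "f x y \<le> g x' y' + c" using x(2)[OF y] by blast
      then show ?thesis
        using cSUP_upper[OF y'(1) bounded_payoffD(1)[OF assms(2) x']] by simp
    qed
    then have "minimax X Y f \<le> (SUP y'\<in>Y'. g x' y') + c"
      by (intro minimax_le[OF assms(1,3) x(1)])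
    then show ?thesis by simp
  qed
  then have "minimax X Y f - c \<le> minimax X' Y' g"
    using assms(4) unfolding minimax_def[of X'] by (intro cINF_greatest)
  then show ?thesis by simp
qed

lemma minimax_diff_le:
  assumes "bounded_payoff X Y f" "bounded_payoff X Y g" "X \<noteq> {}" "Y \<noteq> {}"
    and "\<And>x y. x \<in> X \<Longrightarrow> y \<in> Y \<Longrightarrow> \<bar>f x y - g x y\<bar> \<le> c"
  shows "\<bar>minimax X Y f - minimax X Y g\<bar> \<le> c"
proof -
  have "f x y \<le> g x y + c" "g x y \<le> f x y + c" if "x \<in> X" "y \<in> Y" for x y
    using assms(5)[OF that] by auto
  then have "minimax X Y f \<le> minimax X Y g + c" "minimax X Y g \<le> minimax X Y f + c"
    using assms(1-4) by (intro minimax_mono; blast)+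
  then show ?thesis by simp
qed

section \<open>Saddle points\<close>

definition saddle_point :: "'a set \<Rightarrow> 'b set \<Rightarrow> ('a \<Rightarrow> 'b \<Rightarrow> real) \<Rightarrow> 'a \<Rightarrow> 'b \<Rightarrow> bool" where
  "saddle_point X Y f x y \<longleftrightarrow>
     x \<in> X \<and> y \<in> Y \<and> (\<forall>x'\<in>X. f x y \<le> f x' y) \<and> (\<forall>y'\<in>Y. f x y' \<le> f x y)"

lemma minimax_saddle_point:
  assumes "bounded_payoff X Y f" "saddle_point X Y f x y"
  shows "minimax X Y f = f x y"
  using assms unfolding saddle_point_def
  by (intro antisym minimax_le[of X Y f x] minimax_ge[of X Y f y]) auto

text \<open>Optimality of \<open>x\<close> and of \<open>y\<close>, joined by \<open>mm\<close>,
  places the best reply to \<open>x\<close> no higher than the worst case of \<open>y\<close>. The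
  payoff \<open>f x y\<close> lies between these two numbers in the opposite order, so everything
  collapses to equality.\<close>

lemma saddle_pointI:
  assumes bp: "bounded_payoff X Y f" and ne: "X \<noteq> {}" "Y \<noteq> {}"
    and x: "is_argmin_max X Y f x" and y: "is_argmax_min X Y f y"
    and mm: "(INF x\<in>X. SUP y\<in>Y. f x y) \<le> (SUP y\<in>Y. INF x\<in>X. f x y)"
  shows "saddle_point X Y f x y"
proof -
  have xX: "x \<in> X" and xm: "\<And>x'. x' \<in> X \<Longrightarrow> (SUP y\<in>Y. f x y) \<le> (SUP y\<in>Y. f x' y)"
    using x unfolding is_argmin_max_def is_arg_min_def by force+
  have yY: "y \<in> Y" and ym: "\<And>y'. y' \<in> Y \<Longrightarrow> (INF x\<in>X. f x y') \<le> (INF x\<in>X. f x y)"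
    using y unfolding is_argmax_min_def is_arg_max_def by force+
  have "(SUP y\<in>Y. f x y) \<le> (INF x\<in>X. SUP y\<in>Y. f x y)"
    using ne xm by (intro cINF_greatest) auto
  also note mm
  also have "(SUP y\<in>Y. INF x\<in>X. f x y) \<le> (INF x\<in>X. f x y)"
    using ne ym by (intro cSUP_least) auto
  finally have le: "(SUP y\<in>Y. f x y) \<le> (INF x\<in>X. f x y)" .
  have up: "f x y' \<le> (SUP y\<in>Y. f x y)" if "y' \<in> Y" for y'
    using that by (intro cSUP_upper bounded_payoffD(1)[OF bp xX])
  have lo: "(INF x\<in>X. f x y) \<le> f x' y" if "x' \<in> X" for x'
    using that by (intro cINF_lower bounded_payoffD(2)[OF bp yY])
  have "f x y \<le> f x' y" if "x' \<in> X" for x'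
    using up[OF yY] le lo[OF that] by linarith
  moreover have "f x y' \<le> f x y" if "y' \<in> Y" for y'
    using up[OF that] le lo[OF xX] by linarith
  ultimately show ?thesis using xX yY by (simp add: saddle_point_def)
qed

subsection \<open>Strong convexity on sets of vectors\<close>

definition vec_dist :: "real vec \<Rightarrow> real vec \<Rightarrow> real" where
  "vec_dist x y = L2_set (\<lambda>i. x $ i - y $ i) {..<dim_vec y}"

lemma vec_dist_nonneg [simp]: "0 \<le> vec_dist x y"
  unfolding vec_dist_def by (rule L2_set_nonneg)

definition convex_vec_set :: "real vec set \<Rightarrow> bool" where
  "convex_vec_set S \<longleftrightarrow>
     (\<forall>x\<in>S. \<forall>y\<in>S. \<forall>t\<in>{0..1}. (1 - t) \<cdot>\<^sub>v x + t \<cdot>\<^sub>v y \<in> S)"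

lemma convex_vec_setD:
  assumes "convex_vec_set S" "x \<in> S" "y \<in> S" "0 \<le> t" "t \<le> 1"
  shows "(1 - t) \<cdot>\<^sub>v x + t \<cdot>\<^sub>v y \<in> S"
  using assms(1)[unfolded convex_vec_set_def, rule_format, OF assms(2,3), of t] assms(4,5) by simp

text \<open>Strong convexity in the Euclidean norm. Modulus 0 is plain convexity, and concavity is
  expressed through the negated function.\<close>

definition strongly_convex :: "real vec set \<Rightarrow> real \<Rightarrow> (real vec \<Rightarrow> real) \<Rightarrow> bool" where
  "strongly_convex S \<mu> f \<longleftrightarrow>
     (\<forall>x\<in>S. \<forall>y\<in>S. \<forall>t\<in>{0..1}. f ((1 - t) \<cdot>\<^sub>v x + t \<cdot>\<^sub>v y)
        \<le> (1 - t) * f x + t * f y - \<mu> / 2 * t * (1 - t) * (vec_dist x y)\<^sup>2)"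

lemma strongly_convexD:
  assumes "strongly_convex S \<mu> f" "x \<in> S" "y \<in> S" "0 \<le> t" "t \<le> 1"
  shows "f ((1 - t) \<cdot>\<^sub>v x + t \<cdot>\<^sub>v y)
    \<le> (1 - t) * f x + t * f y - \<mu> / 2 * t * (1 - t) * (vec_dist x y)\<^sup>2"
  using assms(1)[unfolded strongly_convex_def, rule_format, OF assms(2,3), of t] assms(4,5) by simp

lemma strongly_convex_midpoint:
  assumes "strongly_convex S \<mu> f" "x \<in> S" "y \<in> S"
  shows "f ((1 / 2) \<cdot>\<^sub>v x + (1 / 2) \<cdot>\<^sub>v y) \<le> (f x + f y) / 2 - \<mu> / 8 * (vec_dist x y)\<^sup>2"
proof -
  have "f ((1 - 1 / 2) \<cdot>\<^sub>v x + (1 / 2) \<cdot>\<^sub>v y)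
      \<le> (1 - 1 / 2) * f x + 1 / 2 * f y - \<mu> / 2 * (1 / 2) * (1 - 1 / 2) * (vec_dist x y)\<^sup>2"
    by (intro strongly_convexD[OF assms]) auto
  then show ?thesis by (simp add: field_simps)
qed

lemma strongly_convex_mono:
  assumes "strongly_convex S \<mu> f" "\<nu> \<le> \<mu>"
  shows "strongly_convex S \<nu> f"
  unfolding strongly_convex_def
proof (intro ballI)
  fix x y t assume "x \<in> S" "y \<in> S" "t \<in> {0..1::real}"
  then have *: "x \<in> S" "y \<in> S" "0 \<le> t" "t \<le> 1" by auto
  have "\<nu> * (t * (1 - t) * (vec_dist x y)\<^sup>2) \<le> \<mu> * (t * (1 - t) * (vec_dist x y)\<^sup>2)"
    using assms(2) * by (intro mult_right_mono) auto
  with strongly_convexD[OF assms(1) *]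
  show "f ((1 - t) \<cdot>\<^sub>v x + t \<cdot>\<^sub>v y)
      \<le> (1 - t) * f x + t * f y - \<nu> / 2 * t * (1 - t) * (vec_dist x y)\<^sup>2"
    by (simp add: mult.assoc)
qed

lemma strongly_convex_sum:
  assumes "finite I" "\<And>i. i \<in> I \<Longrightarrow> strongly_convex S \<mu> (f i)"
  shows "strongly_convex S (real (card I) * \<mu>) (\<lambda>x. \<Sum>i\<in>I. f i x)"
  using assms
proof (induction I rule: finite_induct)
  case empty
  then show ?case by (simp add: strongly_convex_def)
next
  case (insert j I)
  have 1: "strongly_convex S \<mu> (f j)" and 2: "strongly_convex S (real (card I) * \<mu>) (\<lambda>x. \<Sum>i\<in>I. f i x)"
    using insert by auto
  show ?case
    unfolding strongly_convex_def
  proof (intro ballI)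
    fix x y t assume "x \<in> S" "y \<in> S" "t \<in> {0..1::real}"
    then have *: "x \<in> S" "y \<in> S" "0 \<le> t" "t \<le> 1" by auto
    show "(\<Sum>i\<in>insert j I. f i ((1 - t) \<cdot>\<^sub>v x + t \<cdot>\<^sub>v y))
       \<le> (1 - t) * (\<Sum>i\<in>insert j I. f i x) + t * (\<Sum>i\<in>insert j I. f i y)
         - real (card (insert j I)) * \<mu> / 2 * t * (1 - t) * (vec_dist x y)\<^sup>2"
      using strongly_convexD[OF 1 *] strongly_convexD[OF 2 *] insert.hyps
      by (simp add: algebra_simps add_divide_distrib diff_divide_distrib)
  qed
qed

text \<open>Only a lower bound \<open>m\<close> is required, not a minimiser. With \<open>m\<close>
  slightly below both values it shows that near-minimisers are close to each other; with
  \<open>m = f y\<close> it is quadratic growth around a minimiser, with constant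
  \<open>\<mu> / 4\<close>.\<close>

lemma strongly_convex_near_min:
  assumes "strongly_convex S \<mu> f" "convex_vec_set S" "x \<in> S" "y \<in> S"
    and min: "\<And>z. z \<in> S \<Longrightarrow> m \<le> f z"
  shows "\<mu> / 4 * (vec_dist x y)\<^sup>2 \<le> f x + f y - 2 * m"
proof -
  have "(1 - 1 / 2) \<cdot>\<^sub>v x + (1 / 2) \<cdot>\<^sub>v y \<in> S"
    by (intro convex_vec_setD[OF assms(2-4)]) auto
  then have "m \<le> f ((1 / 2) \<cdot>\<^sub>v x + (1 / 2) \<cdot>\<^sub>v y)" using min by simp
  with strongly_convex_midpoint[OF assms(1,3,4)] show ?thesis by (simp add: field_simps)
qed

subsection \<open>The minimax theorem\<close>

text \<open>No compactness is needed: strong concavity makes approximate best responses to nearby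
  points close to each other, so an approximate best response to an approximate minimiser of
  the outer function is an approximately optimal second strategy.\<close>

lemma minimax_strongly_concave:
  assumes bp: "bounded_payoff X Y f" and ne: "X \<noteq> {}" "Y \<noteq> {}"
    and X: "convex_vec_set X" and Y: "convex_vec_set Y" and \<mu>: "\<mu> > 0"
    and cvx: "\<And>y. y \<in> Y \<Longrightarrow> strongly_convex X 0 (\<lambda>x. f x y)"
    and ccv: "\<And>x. x \<in> X \<Longrightarrow> strongly_convex Y \<mu> (\<lambda>y. - f x y)"
    and lip: "\<And>x y y'. x \<in> X \<Longrightarrow> y \<in> Y \<Longrightarrow> y' \<in> Y \<Longrightarrow> f x y - f x y' \<le> G * vec_dist y y'"
  shows "(INF x\<in>X. SUP y\<in>Y. f x y) \<le> (SUP y\<in>Y. INF x\<in>X. f x y)"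
proof -
  define \<phi> where "\<phi> x = (SUP y\<in>Y. f x y)" for x
  define v where "v = (INF x\<in>X. \<phi> x)"
  define w where "w = (SUP y\<in>Y. INF x\<in>X. f x y)"
  obtain B where B: "\<And>x y. x \<in> X \<Longrightarrow> y \<in> Y \<Longrightarrow> \<bar>f x y\<bar> \<le> B"
    using bp unfolding bounded_payoff_def by blast
  have le_\<phi>: "f x y \<le> \<phi> x" if "x \<in> X" "y \<in> Y" for x y
    unfolding \<phi>_def using that by (intro cSUP_upper bounded_payoffD(1)[OF bp])
  have v_le: "v \<le> \<phi> x" if "x \<in> X" for x
    unfolding v_def \<phi>_def using that ne by (intro cINF_lower bounded_payoffD(3)[OF bp])
  obtain y1 where "y1 \<in> Y" using ne by blast
  have "- B \<le> minimax X Y f"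
  proof (rule minimax_ge[OF bp ne(1) \<open>y1 \<in> Y\<close>])
    show "- B \<le> f x y1" if "x \<in> X" for x using B[OF that \<open>y1 \<in> Y\<close>] by linarith
  qed
  then have vB: "- B \<le> v" by (simp add: minimax_def v_def \<phi>_def)
  \<comment> \<open>\<open>K\<close> is read off the final estimate
    \<open>\<mu> / 8 * ?D \<le> t * (3 + 2 * B)\<close> on the squared distance of two
    replies.\<close>
  define K where "K = 8 * (3 + 2 * B) / \<mu>"
  have G0: "f x y - f x y' \<le> \<bar>G\<bar> * vec_dist y y'" if "x \<in> X" "y \<in> Y" "y' \<in> Y" for x y y'
    using lip[OF that] by (smt (verit) abs_ge_self mult_right_mono vec_dist_nonneg)
  \<comment> \<open>The parameter \<open>t\<close> is both the step length towards \<open>x\<close>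
    and the slack of \<open>y0\<close>. The slacks of \<open>x0\<close> and \<open>y\<close> are
    \<open>t\<^sup>2\<close>, because they are divided by the step length and must still vanish with
    \<open>t\<close>.\<close>
  have key: "v - 2 * t - \<bar>G\<bar> * sqrt (K * t) \<le> w" if t: "0 < t" "t \<le> 1 / 2" for t
  proof -
    have "\<exists>x\<in>X. \<phi> x < v + t\<^sup>2"
    proof -
      have "v < v + t\<^sup>2" using t by simp
      then show ?thesis
        unfolding v_def using cINF_less_iff[OF ne(1) bounded_payoffD(3)[OF bp ne(2)]]
        unfolding \<phi>_def by blast
    qed
    then obtain x0 where x0: "x0 \<in> X" "\<phi> x0 < v + t\<^sup>2" by blast
    have near: "\<exists>y\<in>Y. f x y > \<phi> x - s" if "x \<in> X" "0 < s" for x s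
    proof -
      have "\<phi> x - s < (SUP y\<in>Y. f x y)" using that unfolding \<phi>_def by simp
      then show ?thesis
        using less_cSUP_iff[OF ne(2) bounded_payoffD(1)[OF bp \<open>x \<in> X\<close>]] by simp
    qed
    obtain y0 where y0: "y0 \<in> Y" "f x0 y0 > \<phi> x0 - t" using near[OF x0(1) t(1)] by blast
    have lower: "v - 2 * t - \<bar>G\<bar> * sqrt (K * t) \<le> f x y0" if x: "x \<in> X" for x
    proof -
      \<comment> \<open>A small step from the near-minimiser \<open>x0\<close> towards
        \<open>x\<close> cannot push the outer function below \<open>v\<close>. By convexity, a
        near-best reply \<open>y\<close> to the moved point must then earn almost \<open>v\<close>
        against \<open>x\<close> itself.\<close>
      define xt where "xt = (1 - t) \<cdot>\<^sub>v x0 + t \<cdot>\<^sub>v x"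
      have xt: "xt \<in> X" unfolding xt_def using t by (intro convex_vec_setD[OF X x0(1) x]) auto
      obtain y where y: "y \<in> Y" "f xt y > \<phi> xt - t\<^sup>2" using near[OF xt, of "t\<^sup>2"] t by auto
      have conv: "f xt y \<le> (1 - t) * f x0 y + t * f x y"
        using strongly_convexD[OF cvx[OF y(1)] x0(1) x, of t] t
        unfolding xt_def by simp
      then have main: "v - t\<^sup>2 \<le> (1 - t) * f x0 y + t * f x y"
        using v_le[OF xt] y(2) by linarith
      have "(1 - t) * f x0 y \<le> (1 - t) * (v + t\<^sup>2)"
        using le_\<phi>[OF x0(1) y(1)] x0(2) t by (intro mult_left_mono) auto
      then have "t * (v - 2 * t) \<le> t * f x y - t * t\<^sup>2"
        using main by (simp add: algebra_simps power2_eq_square)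
      moreover have "0 \<le> t * t\<^sup>2" using t(1) by (intro mult_nonneg_nonneg) auto
      ultimately have "t * (v - 2 * t) \<le> t * f x y" by linarith
      then have fxy: "v - 2 * t \<le> f x y" using t(1) by (rule mult_left_le_imp_le)
      \<comment> \<open>\<open>main\<close> is used again, now with \<open>f x y \<le> B\<close>: it
        makes \<open>y\<close> optimal against \<open>x0\<close> up to order \<open>t\<close>. So is
        \<open>y0\<close>, hence the two are within order sqrt(t), and \<open>y0\<close>, which was
        chosen before \<open>x\<close>, can replace \<open>y\<close>.\<close>
      let ?D = "(vec_dist y y0)\<^sup>2"
      have "\<mu> / 4 * ?D \<le> - f x0 y - f x0 y0 + 2 * \<phi> x0"
        using strongly_convex_near_min[OF ccv[OF x0(1)] Y y(1) y0(1), of "- \<phi> x0"] le_\<phi>[OF x0(1)]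
        by simp
      then have "f x0 y \<le> v + t\<^sup>2 + t - \<mu> / 4 * ?D" using y0(2) x0(2) by linarith
      then have "(1 - t) * f x0 y \<le> (1 - t) * (v + t\<^sup>2 + t - \<mu> / 4 * ?D)"
        using t by (intro mult_left_mono) auto
      moreover have "t * f x y \<le> t * B" using B[OF x y(1)] t by (intro mult_left_mono) auto
      ultimately have "(1 - t) * (\<mu> / 4 * ?D) \<le> t\<^sup>2 + (1 - t) * (t\<^sup>2 + t) + t * (B - v)"
        using main by (simp add: algebra_simps)
      moreover have "(1 / 2) * (\<mu> / 4 * ?D) \<le> (1 - t) * (\<mu> / 4 * ?D)"
        using t \<mu> by (intro mult_right_mono) auto
      moreover have "t\<^sup>2 \<le> t" using t mult_left_le[of t t] by (simp add: power2_eq_square)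
      moreover have "(1 - t) * (t\<^sup>2 + t) = t - t * t\<^sup>2"
        by (simp add: algebra_simps power2_eq_square)
      moreover have "0 \<le> t * t\<^sup>2" using t(1) by (intro mult_nonneg_nonneg) auto
      moreover have "t * (B - v) \<le> t * (2 * B)" using vB t by (intro mult_left_mono) auto
      moreover have "t * (3 + 2 * B) = 3 * t + t * (2 * B)" by (simp add: distrib_left)
      ultimately have "\<mu> / 8 * ?D \<le> t * (3 + 2 * B)" using t by linarith
      then have "?D \<le> K * t" unfolding K_def using \<mu> by (simp add: field_simps)
      then have "vec_dist y y0 \<le> sqrt (K * t)" using real_le_rsqrt by blast
      then have "\<bar>G\<bar> * vec_dist y y0 \<le> \<bar>G\<bar> * sqrt (K * t)" by (intro mult_left_mono) auto
      with G0[OF x y(1) y0(1)] fxy show ?thesis by linarith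
    qed
    have "v - 2 * t - \<bar>G\<bar> * sqrt (K * t) \<le> (INF x\<in>X. f x y0)"
      by (rule cINF_greatest[OF ne(1) lower])
    also have "\<dots> \<le> w"
      unfolding w_def by (rule cSUP_upper[OF y0(1) bounded_payoffD(4)[OF bp ne(1)]])
    finally show ?thesis .
  qed
  have lim: "((\<lambda>t. v - 2 * t - \<bar>G\<bar> * sqrt (K * t)) \<longlongrightarrow> v - 2 * 0 - \<bar>G\<bar> * sqrt (K * 0)) (at_right 0)"
    by (intro tendsto_intros)
  have "v - 2 * 0 - \<bar>G\<bar> * sqrt (K * 0) \<le> w"
  proof (rule tendsto_upperbound[OF lim])
    show "\<forall>\<^sub>F t in at_right 0. v - 2 * t - \<bar>G\<bar> * sqrt (K * t) \<le> w"
      unfolding eventually_at_right_field using key by (intro exI[of _ "1/2"]) auto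
  qed simp
  then show ?thesis by (simp add: v_def w_def \<phi>_def)
qed

subsection \<open>Regret of regularised follow-the-leader in a zero-sum game\<close>

lemma linear_minus_quadratic_le:
  fixes a c G :: real
  assumes "c > 0"
  shows "G * a - c * a\<^sup>2 \<le> G\<^sup>2 / (4 * c)"
proof -
  have "0 \<le> (2 * c * a - G)\<^sup>2" by simp
  then have "4 * c * (G * a - c * a\<^sup>2) \<le> G\<^sup>2"
    by (simp add: power2_eq_square algebra_simps)
  with assms show ?thesis by (simp add: field_simps)
qed

lemma bounded_payoff_add:
  assumes "bounded_payoff X Y f" "bounded_payoff X Y g"
  shows "bounded_payoff X Y (\<lambda>x y. f x y + g x y)"
proof -
  obtain B C where "\<And>x y. x \<in> X \<Longrightarrow> y \<in> Y \<Longrightarrow> \<bar>f x y\<bar> \<le> B" "\<And>x y. x \<in> X \<Longrightarrow> y \<in> Y \<Longrightarrow> \<bar>g x y\<bar> \<le> C"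
    using assms unfolding bounded_payoff_def by blast
  then have "\<bar>f x y + g x y\<bar> \<le> B + C" if "x \<in> X" "y \<in> Y" for x y
    using that by (smt (verit) abs_triangle_ineq)
  then show ?thesis unfolding bounded_payoff_def by blast
qed

lemma bounded_payoff_sum:
  assumes "\<And>i. i \<in> I \<Longrightarrow> bounded_payoff X Y (f i)"
  shows "bounded_payoff X Y (\<lambda>x y. \<Sum>i\<in>I. f i x y)"
  using assms
proof (induction I rule: infinite_finite_induct)
  case (insert i I)
  then show ?case using bounded_payoff_add[of X Y "f i"] by simp
qed (auto simp: bounded_payoff_def)

text \<open>Follow-the-leader carried out on values: consecutive iterates are never compared, only
  consecutive minimax values. The initial pair is arbitrary and is charged the Lipschitz constant
  times the diameter; \<open>harm n\<close> accounts for the 0-based rounds 1 to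
  \<open>n\<close>.\<close>

lemma saddle_regret:
  fixes L :: "nat \<Rightarrow> real vec \<Rightarrow> real vec \<Rightarrow> real"
  assumes X: "convex_vec_set X" and Y: "convex_vec_set Y" and \<mu>: "\<mu> > 0" and G: "G \<ge> 0"
    and bp: "\<And>t. t < T \<Longrightarrow> bounded_payoff X Y (L t)"
    and xy: "\<And>t. t < T \<Longrightarrow> x t \<in> X \<and> y t \<in> Y"
    and saddle: "\<And>t. 0 < t \<Longrightarrow> t < T \<Longrightarrow> saddle_point X Y (\<lambda>x y. \<Sum>s<t. L s x y) (x t) (y t)"
    and cvx: "\<And>t v. t < T \<Longrightarrow> v \<in> Y \<Longrightarrow> strongly_convex X \<mu> (\<lambda>u. L t u v)"
    and ccv: "\<And>t u. t < T \<Longrightarrow> u \<in> X \<Longrightarrow> strongly_convex Y \<mu> (\<lambda>v. - L t u v)"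
    and lipX: "\<And>t u. t < T \<Longrightarrow> u \<in> X \<Longrightarrow> L t (x t) (y t) - L t u (y t) \<le> G * vec_dist u (x t)"
    and lipY: "\<And>t v. t < T \<Longrightarrow> v \<in> Y \<Longrightarrow> L t (x t) v - L t (x t) (y t) \<le> G * vec_dist v (y t)"
    and diamX: "\<And>u v. u \<in> X \<Longrightarrow> v \<in> X \<Longrightarrow> vec_dist u v \<le> D"
    and diamY: "\<And>u v. u \<in> Y \<Longrightarrow> v \<in> Y \<Longrightarrow> vec_dist u v \<le> D"
    and n: "n < T"
  shows "\<bar>(\<Sum>t<Suc n. L t (x t) (y t)) - minimax X Y (\<lambda>x y. \<Sum>t<Suc n. L t x y)\<bar>
    \<le> G * D + G\<^sup>2 / \<mu> * harm n"
  using n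
proof (induction n)
  case 0
  note T = \<open>0 < T\<close>
  have ne: "X \<noteq> {}" "Y \<noteq> {}" using xy[OF T] by auto
  have 1: "L 0 (x 0) v \<le> L 0 (x 0) (y 0) + G * D" if "v \<in> Y" for v
    using lipY[OF T that] mult_left_mono[OF diamY[of v "y 0"] G] xy[OF T] that by simp
  have 2: "L 0 (x 0) (y 0) - G * D \<le> L 0 u (y 0)" if "u \<in> X" for u
    using lipX[OF T that] mult_left_mono[OF diamX[of u "x 0"] G] xy[OF T] that by simp
  have "minimax X Y (L 0) \<le> L 0 (x 0) (y 0) + G * D"
    using minimax_le[OF bp[OF T] ne(2) _ 1] xy[OF T] by simp
  moreover have "L 0 (x 0) (y 0) - G * D \<le> minimax X Y (L 0)"
    using minimax_ge[OF bp[OF T] ne(1) _ 2] xy[OF T] by simp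
  ultimately show ?case by (simp add: harm_def abs_le_iff)
next
  case (Suc n)
  define t where "t = Suc n"
  have t: "0 < t" "t < T" using Suc.prems by (auto simp: t_def)
  define F where "F u v = (\<Sum>s<t. L s u v)" for u v
  \<comment> \<open>This is the growth constant of \<open>strongly_convex_near_min\<close> for
    \<open>t\<close> accumulated losses, so \<open>G\<^sup>2 / (4 * c)\<close> is
    \<open>G\<^sup>2 / (\<mu> * t)\<close>, a harmonic term.\<close>
  define c where "c = real t * \<mu> / 4"
  have c: "c > 0" using t(1) \<mu> by (simp add: c_def)
  have xt: "x t \<in> X" and yt: "y t \<in> Y" using xy[OF t(2)] by auto
  have ne: "X \<noteq> {}" "Y \<noteq> {}" using xt yt by auto
  have bpF: "bounded_payoff X Y F"
    unfolding F_def using bp t by (intro bounded_payoff_sum) auto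
  have bpS: "bounded_payoff X Y (\<lambda>u v. F u v + L t u v)"
    by (rule bounded_payoff_add[OF bpF bp[OF t(2)]])
  have sp: "saddle_point X Y F (x t) (y t)"
    using saddle[OF t] unfolding F_def .
  have val: "minimax X Y F = F (x t) (y t)" by (rule minimax_saddle_point[OF bpF sp])
  have scX: "strongly_convex X (real t * \<mu>) (\<lambda>u. F u (y t))"
    using strongly_convex_sum[of "{..<t}" X \<mu> "\<lambda>s u. L s u (y t)"] cvx[OF _ yt] t by (simp add: F_def)
  have scY: "strongly_convex Y (real t * \<mu>) (\<lambda>v. - F (x t) v)"
    using strongly_convex_sum[of "{..<t}" Y \<mu> "\<lambda>s v. - L s (x t) v"] ccv[OF _ xt] t
    by (simp add: F_def sum_negf)
  \<comment> \<open>Leaving \<open>y t\<close> loses quadratically in \<open>F\<close> and gains at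
    most linearly in the new loss. With the mirror estimate \<open>2\<close>, the old saddle point
    is an approximate one for the new sum, and the two one-sided tests pin down its value.\<close>
  have 1: "F (x t) v + L t (x t) v \<le> F (x t) (y t) + L t (x t) (y t) + G\<^sup>2 / (4 * c)" if v: "v \<in> Y" for v
  proof -
    have "c * (vec_dist v (y t))\<^sup>2 \<le> F (x t) (y t) - F (x t) v"
      using strongly_convex_near_min[OF scY Y v yt, of "- F (x t) (y t)"] sp
      by (simp add: saddle_point_def c_def)
    with lipY[OF t(2) v] linear_minus_quadratic_le[OF c, of G "vec_dist v (y t)"]
    show ?thesis by linarith
  qed
  have 2: "F (x t) (y t) + L t (x t) (y t) - G\<^sup>2 / (4 * c) \<le> F u (y t) + L t u (y t)" if u: "u \<in> X" for u
  proof -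
    have "c * (vec_dist u (x t))\<^sup>2 \<le> F u (y t) - F (x t) (y t)"
      using strongly_convex_near_min[OF scX X u xt, of "F (x t) (y t)"] sp
      by (simp add: saddle_point_def c_def)
    with lipX[OF t(2) u] linear_minus_quadratic_le[OF c, of G "vec_dist u (x t)"]
    show ?thesis by linarith
  qed
  have "\<bar>minimax X Y (\<lambda>u v. F u v + L t u v) - (minimax X Y F + L t (x t) (y t))\<bar> \<le> G\<^sup>2 / (4 * c)"
    using minimax_le[OF bpS ne(2) xt 1] minimax_ge[OF bpS ne(1) yt 2] val by (simp add: abs_le_iff)
  moreover have "G\<^sup>2 / (4 * c) = G\<^sup>2 / \<mu> * inverse (real t)"
    by (simp add: c_def field_simps)
  moreover have "\<bar>(\<Sum>t<t. L t (x t) (y t)) - minimax X Y F\<bar> \<le> G * D + G\<^sup>2 / \<mu> * harm n"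
    using Suc unfolding F_def t_def by simp
  moreover have "harm t = harm n + inverse (real t)" by (simp add: t_def harm_Suc)
  ultimately have "\<bar>(\<Sum>t<t. L t (x t) (y t)) + L t (x t) (y t) - minimax X Y (\<lambda>u v. F u v + L t u v)\<bar>
      \<le> G * D + G\<^sup>2 / \<mu> * harm t"
    by (simp add: distrib_left)
  then show ?case by (simp add: t_def[symmetric] F_def[symmetric])
qed

lemma harm_le_ln: "harm (Suc n) \<le> 1 + ln (real (Suc n))"
proof (induction n)
  case 0
  then show ?case by (simp add: harm_def)
next
  case (Suc n)
  have "ln (real (Suc n) / real (Suc (Suc n))) \<le> real (Suc n) / real (Suc (Suc n)) - 1"
    by (intro ln_le_minus_one) simp
  moreover have "real (Suc n) / real (Suc (Suc n)) - 1 = - inverse (real (Suc (Suc n)))"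
    by (simp add: field_simps)
  moreover have "ln (real (Suc n) / real (Suc (Suc n))) = ln (real (Suc n)) - ln (real (Suc (Suc n)))"
    by (simp add: ln_div)
  ultimately show ?case using Suc by (simp add: harm_Suc[of "Suc n"])
qed

subsection \<open>The truncated simplex\<close>

lemma prob_simplexD:
  assumes "x \<in> prob_simplex d"
  shows "dim_vec x = d" "x \<in> carrier_vec d" "i < d \<Longrightarrow> 0 \<le> x $ i" "(\<Sum>i<d. x $ i) = 1"
    "i < d \<Longrightarrow> x $ i \<le> 1"
proof -
  show "dim_vec x = d" "x \<in> carrier_vec d" and nn: "\<And>i. i < d \<Longrightarrow> 0 \<le> x $ i"
    using assms by (auto simp: prob_simplex_def)
  have "(\<Sum>i<d. \<bar>x $ i\<bar>) = (\<Sum>i<d. x $ i)" using nn by (intro sum.cong) auto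
  then show s: "(\<Sum>i<d. x $ i) = 1"
    using assms by (simp add: prob_simplex_def)
  show "i < d \<Longrightarrow> x $ i \<le> 1"
    using member_le_sum[of i "{..<d}" "\<lambda>i. x $ i"] nn s by simp
qed

lemma trunc_simplexD:
  assumes "x \<in> trunc_simplex d \<delta>"
  shows "x \<in> prob_simplex d" "i < d \<Longrightarrow> \<delta> \<le> x $ i"
  using assms by (auto simp: trunc_simplex_def)

lemma convex_trunc_simplex: "convex_vec_set (trunc_simplex d \<delta>)"
  unfolding convex_vec_set_def
proof (intro ballI)
  fix x y and t :: real assume x: "x \<in> trunc_simplex d \<delta>" and y: "y \<in> trunc_simplex d \<delta>" and t: "t \<in> {0..1}"
  note xd = prob_simplexD[OF trunc_simplexD(1)[OF x]] and yd = prob_simplexD[OF trunc_simplexD(1)[OF y]]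
  let ?z = "(1 - t) \<cdot>\<^sub>v x + t \<cdot>\<^sub>v y"
  have z: "?z $ i = (1 - t) * x $ i + t * y $ i" if "i < d" for i
    using that xd(1) yd(1) by simp
  have nn: "0 \<le> ?z $ i" if "i < d" for i
    using z[OF that] xd(3)[OF that] yd(3)[OF that] t by simp
  have "\<delta> \<le> ?z $ i" if i: "i < d" for i
  proof -
    have "(1 - t) * \<delta> + t * \<delta> \<le> (1 - t) * x $ i + t * y $ i"
      using trunc_simplexD(2)[OF x i] trunc_simplexD(2)[OF y i] t by (intro add_mono mult_left_mono) auto
    then show ?thesis using z[OF i] by (simp add: algebra_simps)
  qed
  moreover have "(\<Sum>i<d. \<bar>?z $ i\<bar>) = (\<Sum>i<d. (1 - t) * x $ i + t * y $ i)"
    using nn z by (intro sum.cong) auto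
  moreover have "\<dots> = (1 - t) * (\<Sum>i<d. x $ i) + t * (\<Sum>i<d. y $ i)"
    by (simp add: sum.distrib sum_distrib_left)
  ultimately show "?z \<in> trunc_simplex d \<delta>"
    unfolding trunc_simplex_def prob_simplex_def using xd yd nn by auto
qed

lemma sum_abs_diff_simplex_le:
  assumes "x \<in> prob_simplex d" "y \<in> prob_simplex d"
  shows "(\<Sum>i<d. \<bar>x $ i - y $ i\<bar>) \<le> 2"
proof -
  have "(\<Sum>i<d. \<bar>x $ i - y $ i\<bar>) \<le> (\<Sum>i<d. x $ i + y $ i)"
    using prob_simplexD(3)[OF assms(1)] prob_simplexD(3)[OF assms(2)]
    by (intro sum_mono) (simp add: abs_le_iff)
  also have "\<dots> = 2" using prob_simplexD(4)[OF assms(1)] prob_simplexD(4)[OF assms(2)]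
    by (simp add: sum.distrib)
  finally show ?thesis .
qed

lemma vec_dist_simplex_le:
  assumes "x \<in> prob_simplex d" "y \<in> prob_simplex d"
  shows "vec_dist x y \<le> 2"
  using L2_set_le_sum_abs[of "\<lambda>i. x $ i - y $ i" "{..<d}"] sum_abs_diff_simplex_le[OF assms]
    prob_simplexD(1)[OF assms(2)]
  by (simp add: vec_dist_def)

lemma abs_diff_le_vec_dist:
  assumes "i < dim_vec y"
  shows "\<bar>x $ i - y $ i\<bar> \<le> vec_dist x y"
proof -
  have "\<bar>x $ i - y $ i\<bar> \<le> L2_set (\<lambda>i. \<bar>x $ i - y $ i\<bar>) {..<dim_vec y}"
    using assms by (intro member_le_L2_set) auto
  then show ?thesis by (simp add: vec_dist_def L2_set_def)
qed

text \<open>The witness mixes \<open>x\<close> with the uniform distribution at weight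
  \<open>d * \<delta>\<close>, which adds \<delta> to every coordinate of the rescaled vector. The
  mass removed and the mass added each contribute \<open>d * \<delta>\<close> to the l1
  distance.\<close>

lemma ex_trunc_simplex_near:
  assumes x: "x \<in> prob_simplex d" and \<delta>: "0 \<le> \<delta>" "real d * \<delta> \<le> 1"
  shows "\<exists>z\<in>trunc_simplex d \<delta>. (\<Sum>i<d. \<bar>z $ i - x $ i\<bar>) \<le> 2 * real d * \<delta>"
proof -
  note xd = prob_simplexD[OF x]
  define z where "z = vec d (\<lambda>i. (1 - real d * \<delta>) * x $ i + \<delta>)"
  have zi: "z $ i = (1 - real d * \<delta>) * x $ i + \<delta>" if "i < d" for i
    using that by (simp add: z_def)
  have ge: "\<delta> \<le> z $ i" if "i < d" for i
    using zi[OF that] xd(3)[OF that] \<delta> by simp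
  have "(\<Sum>i<d. \<bar>z $ i\<bar>) = (\<Sum>i<d. (1 - real d * \<delta>) * x $ i + \<delta>)"
  proof (intro sum.cong refl)
    fix i assume "i \<in> {..<d}"
    then show "\<bar>z $ i\<bar> = (1 - real d * \<delta>) * x $ i + \<delta>"
      using ge[of i] zi[of i] \<delta>(1) by simp
  qed
  also have "\<dots> = (1 - real d * \<delta>) * (\<Sum>i<d. x $ i) + real d * \<delta>"
    by (simp add: sum.distrib sum_distrib_left)
  finally have sum: "(\<Sum>i<d. \<bar>z $ i\<bar>) = 1" using xd(4) by simp
  have "z \<in> trunc_simplex d \<delta>"
    unfolding trunc_simplex_def prob_simplex_def using ge sum \<delta>(1) by (auto simp: z_def intro: order_trans)
  moreover have "(\<Sum>i<d. \<bar>z $ i - x $ i\<bar>) \<le> (\<Sum>i<d. \<delta> + real d * \<delta> * x $ i)"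
  proof (intro sum_mono)
    fix i assume "i \<in> {..<d}"
    then have "z $ i - x $ i = \<delta> - real d * \<delta> * x $ i" "0 \<le> real d * \<delta> * x $ i"
      using zi[of i] xd(3)[of i] \<delta>(1) by (auto simp: algebra_simps)
    then show "\<bar>z $ i - x $ i\<bar> \<le> \<delta> + real d * \<delta> * x $ i" using \<delta>(1) by linarith
  qed
  moreover have "(\<Sum>i<d. \<delta> + real d * \<delta> * x $ i) = real d * \<delta> + real d * \<delta> * (\<Sum>i<d. x $ i)"
    by (simp add: sum.distrib sum_distrib_left)
  ultimately show ?thesis using xd(4) by (intro bexI[of _ z]) (auto simp: algebra_simps)
qed

subsection \<open>The entropy regulariser\<close>

text \<open>The second derivative 1/u of u ln u is at least 1 on (0,1], so subtracting u^2/2 leaves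
  a convex function. The quadratic term of the claim is the convexity defect of u^2/2.\<close>

lemma xlnx_strongly_convex:
  fixes a b t :: real
  assumes "0 < a" "a \<le> 1" "0 < b" "b \<le> 1" "0 \<le> t" "t \<le> 1"
  shows "((1 - t) * a + t * b) * ln ((1 - t) * a + t * b)
    \<le> (1 - t) * (a * ln a) + t * (b * ln b) - 1 / 2 * t * (1 - t) * (a - b)\<^sup>2"
proof -
  have "convex_on {0<..1::real} (\<lambda>u. u * ln u - u\<^sup>2 / 2)"
  proof (rule f''_ge0_imp_convex[where f' = "\<lambda>u. ln u + 1 - u" and f'' = "\<lambda>u. 1 / u - 1"])
    fix u :: real assume "u \<in> {0<..1}"
    then show "((\<lambda>u. u * ln u - u\<^sup>2 / 2) has_real_derivative ln u + 1 - u) (at u)"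
      "((\<lambda>u. ln u + 1 - u) has_real_derivative 1 / u - 1) (at u)"
      "0 \<le> 1 / u - 1"
      by (auto intro!: derivative_eq_intros simp: field_simps)
  qed simp
  from convex_onD[OF this, of t a b] assms
  have "((1 - t) * a + t * b) * ln ((1 - t) * a + t * b) - ((1 - t) * a + t * b)\<^sup>2 / 2
      \<le> (1 - t) * (a * ln a - a\<^sup>2 / 2) + t * (b * ln b - b\<^sup>2 / 2)"
    by simp
  moreover have "((1 - t) * a + t * b)\<^sup>2 / 2 - (1 - t) * (a\<^sup>2 / 2) - t * (b\<^sup>2 / 2)
      = - (1 / 2 * t * (1 - t) * (a - b)\<^sup>2)"
    by (simp add: power2_eq_square field_simps)
  ultimately show ?thesis by (simp add: right_diff_distrib)
qed

lemma neg_entropy_strongly_convex: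
  assumes "\<delta> > 0"
  shows "strongly_convex (trunc_simplex d \<delta>) 1 (neg_entropy d)"
  unfolding strongly_convex_def
proof (intro ballI)
  fix x y and t :: real assume x: "x \<in> trunc_simplex d \<delta>" and y: "y \<in> trunc_simplex d \<delta>" and t: "t \<in> {0..1}"
  note xd = prob_simplexD[OF trunc_simplexD(1)[OF x]] and yd = prob_simplexD[OF trunc_simplexD(1)[OF y]]
  let ?z = "(1 - t) \<cdot>\<^sub>v x + t \<cdot>\<^sub>v y"
  have "(\<Sum>i<d. ?z $ i * ln (?z $ i))
      \<le> (\<Sum>i<d. (1 - t) * (x $ i * ln (x $ i)) + t * (y $ i * ln (y $ i)) - 1 / 2 * t * (1 - t) * (x $ i - y $ i)\<^sup>2)"
  proof (intro sum_mono)
    fix i assume "i \<in> {..<d}"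
    then have i: "i < d" by simp
    have z: "?z $ i = (1 - t) * x $ i + t * y $ i" using i xd(1) yd(1) by simp
    show "?z $ i * ln (?z $ i)
      \<le> (1 - t) * (x $ i * ln (x $ i)) + t * (y $ i * ln (y $ i)) - 1 / 2 * t * (1 - t) * (x $ i - y $ i)\<^sup>2"
      unfolding z
      using xd(5)[OF i] yd(5)[OF i] trunc_simplexD(2)[OF x i] trunc_simplexD(2)[OF y i] t assms
      by (intro xlnx_strongly_convex) auto
  qed
  also have "\<dots> = (1 - t) * (\<Sum>i<d. x $ i * ln (x $ i)) + t * (\<Sum>i<d. y $ i * ln (y $ i))
      - 1 / 2 * t * (1 - t) * (\<Sum>i<d. (x $ i - y $ i)\<^sup>2)"
    by (simp add: sum.distrib sum_subtractf sum_distrib_left)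
  also have "(\<Sum>i<d. (x $ i - y $ i)\<^sup>2) = (vec_dist x y)\<^sup>2"
    using yd(1) by (simp add: vec_dist_def L2_set_def sum_nonneg)
  finally show "neg_entropy d ?z \<le> (1 - t) * neg_entropy d x + t * neg_entropy d y - 1 / 2 * t * (1 - t) * (vec_dist x y)\<^sup>2"
    unfolding neg_entropy_def by (simp add: algebra_simps)
qed

text \<open>A crude substitute for the range [0, ln d], obtained from u - 1 \<le> u ln u alone.
  Linear growth in \<open>d\<close> is affordable because the final bound has the factor d1 +
  d2.\<close>

lemma abs_neg_entropy_le:
  assumes x: "x \<in> trunc_simplex d \<delta>" and "\<delta> > 0" "d \<ge> 1"
  shows "\<bar>neg_entropy d x\<bar> \<le> real d"
proof -
  note xd = prob_simplexD[OF trunc_simplexD(1)[OF x]]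
  have pos: "0 < x $ i" if "i < d" for i using trunc_simplexD(2)[OF x that] assms(2) by simp
  have up: "(\<Sum>i<d. x $ i * ln (x $ i)) \<le> 0"
    using pos xd(5) by (intro sum_nonpos mult_nonneg_nonpos) (auto intro: less_imp_le)
  have "(\<Sum>i<d. x $ i - 1) \<le> (\<Sum>i<d. x $ i * ln (x $ i))"
  proof (intro sum_mono)
    fix i assume "i \<in> {..<d}"
    then have p: "0 < x $ i" using pos by simp
    have "- ln (x $ i) \<le> 1 / x $ i - 1"
      using ln_le_minus_one[of "1 / x $ i"] p by (simp add: ln_div)
    from mult_left_mono[OF this, of "x $ i"] p show "x $ i - 1 \<le> x $ i * ln (x $ i)"
      by (simp add: algebra_simps)
  qed
  then have lo: "1 - real d \<le> (\<Sum>i<d. x $ i * ln (x $ i))"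
    using xd(4) by (simp add: sum_subtractf)
  have "0 \<le> ln (real d)" "ln (real d) \<le> real d - 1" using assms(3) ln_le_minus_one[of "real d"] by auto
  with up lo show ?thesis unfolding neg_entropy_def by linarith
qed

text \<open>The derivative ln u + 1 blows up at 0, and the truncation keeps it finite. Bounding it
  by 1/\<delta> rather than logarithmically is harmless: the estimated payoffs already contribute
  1/\<delta>^2.\<close>

lemma xlnx_lipschitz:
  fixes a b \<delta> :: real
  assumes "0 < \<delta>" "\<delta> \<le> a" "a \<le> 1" "\<delta> \<le> b" "b \<le> 1"
  shows "\<bar>a * ln a - b * ln b\<bar> \<le> 1 / \<delta> * \<bar>a - b\<bar>"
proof -
  have "norm (a * ln a - b * ln b) \<le> 1 / \<delta> * norm (a - b)"
  proof (rule field_differentiable_bound[where S = "{\<delta>..1}" and f' = "\<lambda>u. ln u + 1"])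
    fix u :: real assume u: "u \<in> {\<delta>..1}"
    then show "((\<lambda>u. u * ln u) has_field_derivative ln u + 1) (at u within {\<delta>..1})"
      using assms(1) by (auto intro!: derivative_eq_intros simp: field_simps)
    have "- ln u \<le> 1 / u - 1"
      using ln_le_minus_one[of "1 / u"] u assms(1) by (simp add: ln_div)
    moreover have "1 / u \<le> 1 / \<delta>" using u assms(1) by (simp add: frac_le)
    moreover have "ln u \<le> 0" using u assms(1) by simp
    moreover have "1 \<le> 1 / \<delta>" using assms by simp
    ultimately show "norm (ln u + 1) \<le> 1 / \<delta>" by (simp add: abs_le_iff)
  qed (use assms in auto)
  then show ?thesis by simp
qed

lemma neg_entropy_lipschitz:
  assumes x: "x \<in> trunc_simplex d \<delta>" and y: "y \<in> trunc_simplex d \<delta>" and \<delta>: "\<delta> > 0"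
  shows "\<bar>neg_entropy d x - neg_entropy d y\<bar> \<le> real d / \<delta> * vec_dist x y"
proof -
  note xd = prob_simplexD[OF trunc_simplexD(1)[OF x]] and yd = prob_simplexD[OF trunc_simplexD(1)[OF y]]
  have "\<bar>neg_entropy d x - neg_entropy d y\<bar> = \<bar>\<Sum>i<d. x $ i * ln (x $ i) - y $ i * ln (y $ i)\<bar>"
    by (simp add: neg_entropy_def sum_subtractf)
  also have "\<dots> \<le> (\<Sum>i<d. \<bar>x $ i * ln (x $ i) - y $ i * ln (y $ i)\<bar>)" by (rule sum_abs)
  also have "\<dots> \<le> (\<Sum>i<d. 1 / \<delta> * vec_dist x y)"
  proof (intro sum_mono)
    fix i assume "i \<in> {..<d}"
    then have i: "i < d" by simp
    have "\<bar>x $ i * ln (x $ i) - y $ i * ln (y $ i)\<bar> \<le> 1 / \<delta> * \<bar>x $ i - y $ i\<bar>"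
      using xd(5)[OF i] yd(5)[OF i] trunc_simplexD(2)[OF x i] trunc_simplexD(2)[OF y i] \<delta>
      by (intro xlnx_lipschitz) auto
    also have "\<dots> \<le> 1 / \<delta> * vec_dist x y"
      using abs_diff_le_vec_dist[of i y x] i yd(1) \<delta> by (intro mult_left_mono) auto
    finally show "\<bar>x $ i * ln (x $ i) - y $ i * ln (y $ i)\<bar> \<le> 1 / \<delta> * vec_dist x y" .
  qed
  finally show ?thesis by simp
qed

subsection \<open>Bilinear payoffs and importance-weighted estimates\<close>

text \<open>Coefficients form a plain function instead of a matrix, so that sums and differences
  over rounds need no dimension bookkeeping.\<close>

definition bilin_sum :: "nat \<Rightarrow> nat \<Rightarrow> (nat \<Rightarrow> nat \<Rightarrow> real) \<Rightarrow> real vec \<Rightarrow> real vec \<Rightarrow> real" where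
  "bilin_sum d1 d2 W x y = (\<Sum>i<d1. \<Sum>j<d2. x $ i * W i j * y $ j)"

lemma bilin_eq_bilin_sum:
  assumes "x \<in> carrier_vec d1" "A \<in> carrier_mat d1 d2" "y \<in> carrier_vec d2"
  shows "bilin x A y = bilin_sum d1 d2 (\<lambda>i j. A $$ (i, j)) x y"
  using assms
  by (auto simp: bilin_def bilin_sum_def scalar_prod_def sum_distrib_left atLeast0LessThan mult.assoc
      intro!: sum.cong)

lemma bilin_sum_sum: "(\<Sum>t\<in>I. bilin_sum d1 d2 (W t) x y) = bilin_sum d1 d2 (\<lambda>i j. \<Sum>t\<in>I. W t i j) x y"
proof -
  have "(\<Sum>t\<in>I. bilin_sum d1 d2 (W t) x y) = (\<Sum>i<d1. \<Sum>t\<in>I. \<Sum>j<d2. x $ i * W t i j * y $ j)"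
    unfolding bilin_sum_def by (rule sum.swap)
  also have "\<dots> = (\<Sum>i<d1. \<Sum>j<d2. \<Sum>t\<in>I. x $ i * W t i j * y $ j)"
    by (intro sum.cong refl sum.swap)
  finally show ?thesis by (simp add: bilin_sum_def sum_distrib_left sum_distrib_right)
qed

lemma bilin_sum_diff:
  "bilin_sum d1 d2 V x y - bilin_sum d1 d2 W x y = bilin_sum d1 d2 (\<lambda>i j. V i j - W i j) x y"
  by (simp add: bilin_sum_def sum_subtractf algebra_simps)

text \<open>Hoelder's inequality with the largest entry against the two l1 norms. The vectors are
  arbitrary so that differences of strategies can be inserted.\<close>

lemma abs_bilin_sum_le:
  assumes "\<And>i j. i < d1 \<Longrightarrow> j < d2 \<Longrightarrow> \<bar>W i j\<bar> \<le> c"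
  shows "\<bar>bilin_sum d1 d2 W x y\<bar> \<le> c * (\<Sum>i<d1. \<bar>x $ i\<bar>) * (\<Sum>j<d2. \<bar>y $ j\<bar>)"
proof -
  have "\<bar>bilin_sum d1 d2 W x y\<bar> \<le> (\<Sum>i<d1. \<bar>\<Sum>j<d2. x $ i * W i j * y $ j\<bar>)"
    unfolding bilin_sum_def by (rule sum_abs)
  also have "\<dots> \<le> (\<Sum>i<d1. \<Sum>j<d2. \<bar>x $ i * W i j * y $ j\<bar>)"
    by (intro sum_mono sum_abs)
  also have "\<dots> \<le> (\<Sum>i<d1. \<Sum>j<d2. c * \<bar>x $ i\<bar> * \<bar>y $ j\<bar>)"
  proof (intro sum_mono)
    fix i j assume "i \<in> {..<d1}" "j \<in> {..<d2}"
    then have "\<bar>W i j\<bar> * (\<bar>x $ i\<bar> * \<bar>y $ j\<bar>) \<le> c * (\<bar>x $ i\<bar> * \<bar>y $ j\<bar>)"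
      using assms by (intro mult_right_mono) auto
    then show "\<bar>x $ i * W i j * y $ j\<bar> \<le> c * \<bar>x $ i\<bar> * \<bar>y $ j\<bar>"
      by (simp add: abs_mult mult_ac)
  qed
  also have "\<dots> = c * (\<Sum>i<d1. \<bar>x $ i\<bar>) * (\<Sum>j<d2. \<bar>y $ j\<bar>)"
    by (simp add: sum_distrib_left sum_distrib_right mult_ac)
  finally show ?thesis .
qed

lemma sum_abs_prob_simplex: "x \<in> prob_simplex d \<Longrightarrow> (\<Sum>i<d. \<bar>x $ i\<bar>) = 1"
  unfolding prob_simplex_def by blast

lemma abs_bilin_sum_simplex_le:
  assumes "\<And>i j. i < d1 \<Longrightarrow> j < d2 \<Longrightarrow> \<bar>W i j\<bar> \<le> c" "x \<in> prob_simplex d1" "y \<in> prob_simplex d2"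
  shows "\<bar>bilin_sum d1 d2 W x y\<bar> \<le> c"
  using abs_bilin_sum_le[of d1 d2 W c x y, OF assms(1)]
  unfolding sum_abs_prob_simplex[OF assms(2)] sum_abs_prob_simplex[OF assms(3)] by simp

lemma bilin_sum_lipschitz:
  assumes W: "\<And>i j. i < d1 \<Longrightarrow> j < d2 \<Longrightarrow> \<bar>W i j\<bar> \<le> c"
    and x: "x \<in> prob_simplex d1" "x' \<in> prob_simplex d1"
    and y: "y \<in> prob_simplex d2" "y' \<in> prob_simplex d2"
  shows "\<bar>bilin_sum d1 d2 W x y - bilin_sum d1 d2 W x' y'\<bar>
    \<le> c * ((\<Sum>i<d1. \<bar>x $ i - x' $ i\<bar>) + (\<Sum>j<d2. \<bar>y $ j - y' $ j\<bar>))"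
proof -
  have "bilin_sum d1 d2 W x y - bilin_sum d1 d2 W x' y = bilin_sum d1 d2 W (vec d1 (\<lambda>i. x $ i - x' $ i)) y"
    by (simp add: bilin_sum_def sum_subtractf algebra_simps)
  moreover have "bilin_sum d1 d2 W x' y - bilin_sum d1 d2 W x' y' = bilin_sum d1 d2 W x' (vec d2 (\<lambda>i. y $ i - y' $ i))"
    by (simp add: bilin_sum_def sum_subtractf algebra_simps)
  ultimately show ?thesis
    using abs_bilin_sum_le[of d1 d2 W c "vec d1 (\<lambda>i. x $ i - x' $ i)" y, OF W]
      abs_bilin_sum_le[of d1 d2 W c x' "vec d2 (\<lambda>i. y $ i - y' $ i)", OF W]
    unfolding sum_abs_prob_simplex[OF x(2)] sum_abs_prob_simplex[OF y(1)]
    by (simp add: distrib_left)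
qed

lemma est_mat_carrier: "est_mat d1 d2 A p q a \<in> carrier_mat d1 d2"
  by (cases a) (simp add: est_mat_def)

lemma est_mat_index:
  assumes "k < d1" "l < d2"
  shows "est_mat d1 d2 A p q (i, j) $$ (k, l) = (if k = i \<and> l = j then A $$ (i, j) / (p $ i * q $ j) else 0)"
  using assms by (simp add: est_mat_def)

lemma bilin_est_mat:
  assumes "x \<in> carrier_vec d1" "y \<in> carrier_vec d2" "i < d1" "j < d2"
  shows "bilin x (est_mat d1 d2 A p q (i, j)) y = A $$ (i, j) / (p $ i * q $ j) * x $ i * y $ j"
proof -
  have "bilin x (est_mat d1 d2 A p q (i, j)) y
      = (\<Sum>k<d1. \<Sum>l<d2. if k = i \<and> l = j then A $$ (i, j) / (p $ i * q $ j) * x $ i * y $ j else 0)"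
    unfolding bilin_eq_bilin_sum[OF assms(1) est_mat_carrier assms(2)] bilin_sum_def
    by (intro sum.cong refl) (auto simp: est_mat_index)
  also have "\<dots> = (\<Sum>k<d1. if k = i then A $$ (i, j) / (p $ i * q $ j) * x $ i * y $ j else 0)"
    using assms(4) by (intro sum.cong refl) auto
  finally show ?thesis using assms(3) by simp
qed

lemma abs_weighted_entry_le:
  assumes p: "p \<in> trunc_simplex d1 \<delta>" and q: "q \<in> trunc_simplex d2 \<delta>" and \<delta>: "\<delta> > 0"
    and ij: "i < d1" "j < d2" and A: "\<bar>a\<bar> \<le> 1"
  shows "\<bar>a / (p $ i * q $ j)\<bar> \<le> 1 / \<delta>\<^sup>2"
proof -
  have "\<delta>\<^sup>2 \<le> p $ i * q $ j"
    unfolding power2_eq_square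
    using trunc_simplexD(2)[OF p ij(1)] trunc_simplexD(2)[OF q ij(2)] \<delta> by (intro mult_mono) auto
  then show ?thesis using A \<delta> by (simp add: frac_le)
qed

section \<open>The regularised loss of a single round\<close>

context
  fixes d1 d2 :: nat and \<delta> \<eta> :: real and A :: "real mat" and p q :: "real vec" and i j :: nat
  assumes p: "p \<in> trunc_simplex d1 \<delta>" and q: "q \<in> trunc_simplex d2 \<delta>"
    and \<delta>: "\<delta> > 0" and \<eta>: "\<eta> > 0" and ij: "i < d1" "j < d2" and A: "\<bar>A $$ (i, j)\<bar> \<le> 1"
begin

private abbreviation "M \<equiv> est_mat d1 d2 A p q (i, j)"
private abbreviation "S1 \<equiv> trunc_simplex d1 \<delta>"
private abbreviation "S2 \<equiv> trunc_simplex d2 \<delta>"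

private lemma M_bilin:
  assumes "x \<in> S1" "y \<in> S2"
  shows "bilin x M y = A $$ (i, j) / (p $ i * q $ j) * x $ i * y $ j"
  using assms ij by (intro bilin_est_mat prob_simplexD trunc_simplexD)

private lemma weight: "\<bar>A $$ (i, j) / (p $ i * q $ j)\<bar> \<le> 1 / \<delta>\<^sup>2"
  using p q \<delta> ij A by (rule abs_weighted_entry_le)

lemma bounded_payoff_reg_loss: "bounded_payoff S1 S2 (reg_loss \<eta> d1 d2 M)"
proof -
  have d: "d1 \<ge> 1" "d2 \<ge> 1" using ij by auto
  have "\<bar>reg_loss \<eta> d1 d2 M x y\<bar> \<le> 1 / \<delta>\<^sup>2 + 1 / \<eta> * d1 + 1 / \<eta> * d2" if x: "x \<in> S1" and y: "y \<in> S2" for x y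
  proof -
    note xd = prob_simplexD[OF trunc_simplexD(1)[OF x]] and yd = prob_simplexD[OF trunc_simplexD(1)[OF y]]
    have "\<bar>x $ i * y $ j\<bar> \<le> 1" using xd yd ij by (simp add: abs_mult mult_le_one)
    then have "\<bar>bilin x M y\<bar> \<le> 1 / \<delta>\<^sup>2 * 1"
      unfolding M_bilin[OF x y] mult.assoc abs_mult[of _ "x $ i * y $ j"]
      using weight by (intro mult_mono) auto
    moreover have "\<bar>1 / \<eta> * neg_entropy d1 x\<bar> \<le> 1 / \<eta> * d1"
      using abs_neg_entropy_le[OF x \<delta> d(1)] \<eta> by (simp add: abs_mult divide_right_mono)
    moreover have "\<bar>1 / \<eta> * neg_entropy d2 y\<bar> \<le> 1 / \<eta> * d2"
      using abs_neg_entropy_le[OF y \<delta> d(2)] \<eta> by (simp add: abs_mult divide_right_mono)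
    ultimately show ?thesis unfolding reg_loss_def by linarith
  qed
  then show ?thesis unfolding bounded_payoff_def by blast
qed

lemma reg_loss_strongly_convex:
  assumes y: "y \<in> S2"
  shows "strongly_convex S1 (1 / \<eta>) (\<lambda>x. reg_loss \<eta> d1 d2 M x y)"
  unfolding strongly_convex_def
proof (intro ballI)
  fix x x' t assume x: "x \<in> S1" and x': "x' \<in> S1" and t: "t \<in> {0..1::real}"
  let ?z = "(1 - t) \<cdot>\<^sub>v x + t \<cdot>\<^sub>v x'"
  have z: "?z \<in> S1" using t by (intro convex_vec_setD[OF convex_trunc_simplex x x']) auto
  have "dim_vec x = d1" "dim_vec x' = d1"
    using prob_simplexD(1) trunc_simplexD(1) x x' by blast+
  then have "bilin ?z M y = (1 - t) * bilin x M y + t * bilin x' M y"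
    unfolding M_bilin[OF x y] M_bilin[OF x' y] M_bilin[OF z y] using ij
    by (simp add: algebra_simps add_divide_distrib diff_divide_distrib)
  moreover have "1 / \<eta> * neg_entropy d1 ?z \<le> 1 / \<eta> * ((1 - t) * neg_entropy d1 x + t * neg_entropy d1 x'
      - 1 / 2 * t * (1 - t) * (vec_dist x x')\<^sup>2)"
    using strongly_convexD[OF neg_entropy_strongly_convex[OF \<delta>] x x', of t] t \<eta>
    by (intro mult_left_mono) auto
  ultimately show "reg_loss \<eta> d1 d2 M ?z y \<le> (1 - t) * reg_loss \<eta> d1 d2 M x y
      + t * reg_loss \<eta> d1 d2 M x' y - 1 / \<eta> / 2 * t * (1 - t) * (vec_dist x x')\<^sup>2"
    unfolding reg_loss_def by (simp add: algebra_simps add_divide_distrib diff_divide_distrib)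
qed

lemma reg_loss_strongly_concave:
  assumes x: "x \<in> S1"
  shows "strongly_convex S2 (1 / \<eta>) (\<lambda>y. - reg_loss \<eta> d1 d2 M x y)"
  unfolding strongly_convex_def
proof (intro ballI)
  fix y y' t assume y: "y \<in> S2" and y': "y' \<in> S2" and t: "t \<in> {0..1::real}"
  let ?z = "(1 - t) \<cdot>\<^sub>v y + t \<cdot>\<^sub>v y'"
  have z: "?z \<in> S2" using t by (intro convex_vec_setD[OF convex_trunc_simplex y y']) auto
  have "dim_vec y = d2" "dim_vec y' = d2"
    using prob_simplexD(1) trunc_simplexD(1) y y' by blast+
  then have "bilin x M ?z = (1 - t) * bilin x M y + t * bilin x M y'"
    unfolding M_bilin[OF x y] M_bilin[OF x y'] M_bilin[OF x z] using ij
    by (simp add: algebra_simps add_divide_distrib diff_divide_distrib)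
  moreover have "1 / \<eta> * neg_entropy d2 ?z \<le> 1 / \<eta> * ((1 - t) * neg_entropy d2 y + t * neg_entropy d2 y'
      - 1 / 2 * t * (1 - t) * (vec_dist y y')\<^sup>2)"
    using strongly_convexD[OF neg_entropy_strongly_convex[OF \<delta>] y y', of t] t \<eta>
    by (intro mult_left_mono) auto
  ultimately show "- reg_loss \<eta> d1 d2 M x ?z \<le> (1 - t) * - reg_loss \<eta> d1 d2 M x y
      + t * - reg_loss \<eta> d1 d2 M x y' - 1 / \<eta> / 2 * t * (1 - t) * (vec_dist y y')\<^sup>2"
    unfolding reg_loss_def by (simp add: algebra_simps add_divide_distrib diff_divide_distrib)
qed

text \<open>The estimate has one nonzero entry, so its bilinear form depends on one coordinate of
  each argument and gives 1/\<delta>^2 without a dimension factor. The entropy contributes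
  d/(\<delta> \<eta>); taking d1 + d2 there yields one constant for both players.\<close>

lemma reg_loss_lipschitz:
  assumes x: "x \<in> S1" and y: "y \<in> S2"
  shows "x' \<in> S1 \<Longrightarrow> \<bar>reg_loss \<eta> d1 d2 M x y - reg_loss \<eta> d1 d2 M x' y\<bar>
      \<le> (1 / \<delta>\<^sup>2 + (real d1 + real d2) / (\<delta> * \<eta>)) * vec_dist x x'" (is "_ \<Longrightarrow> ?P x'")
    and "y' \<in> S2 \<Longrightarrow> \<bar>reg_loss \<eta> d1 d2 M x y - reg_loss \<eta> d1 d2 M x y'\<bar>
      \<le> (1 / \<delta>\<^sup>2 + (real d1 + real d2) / (\<delta> * \<eta>)) * vec_dist y y'" (is "_ \<Longrightarrow> ?Q y'")
proof -
  have prod: "\<bar>A $$ (i, j) / (p $ i * q $ j) * b * c\<bar> \<le> 1 / \<delta>\<^sup>2 * e" if "\<bar>b\<bar> \<le> 1" "\<bar>c\<bar> \<le> e" for b c e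
  proof -
    have "\<bar>A $$ (i, j) / (p $ i * q $ j)\<bar> * (\<bar>b\<bar> * \<bar>c\<bar>) \<le> 1 / \<delta>\<^sup>2 * (1 * e)"
      using weight that by (intro mult_mono) auto
    then show ?thesis by (simp add: abs_mult mult_ac)
  qed
  note xd = prob_simplexD[OF trunc_simplexD(1)[OF x]] and yd = prob_simplexD[OF trunc_simplexD(1)[OF y]]
  have reg: "\<bar>1 / \<eta> * r\<bar> \<le> (real d1 + real d2) / (\<delta> * \<eta>) * D"
    if "\<bar>r\<bar> \<le> real d / \<delta> * D" "real d \<le> real d1 + real d2" "0 \<le> D" for r d D
  proof -
    have "\<bar>1 / \<eta> * r\<bar> \<le> 1 / \<eta> * (real d / \<delta> * D)"
      unfolding abs_mult using that(1) \<eta> by (intro mult_mono) auto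
    also have "\<dots> = real d / (\<delta> * \<eta>) * D" by simp
    also have "\<dots> \<le> (real d1 + real d2) / (\<delta> * \<eta>) * D"
      using that \<delta> \<eta> by (intro mult_right_mono divide_right_mono) auto
    finally show ?thesis .
  qed
  show "?P x'" if x': "x' \<in> S1"
  proof -
    note xd' = prob_simplexD[OF trunc_simplexD(1)[OF x']]
    have "bilin x M y - bilin x' M y = A $$ (i, j) / (p $ i * q $ j) * y $ j * (x $ i - x' $ i)"
      unfolding M_bilin[OF x y] M_bilin[OF x' y] by (simp add: algebra_simps diff_divide_distrib)
    then have "\<bar>bilin x M y - bilin x' M y\<bar> \<le> 1 / \<delta>\<^sup>2 * vec_dist x x'"
      using prod[of "y $ j" "x $ i - x' $ i" "vec_dist x x'"] yd ij abs_diff_le_vec_dist[of i x' x] xd'(1) by simp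
    moreover have "\<bar>1 / \<eta> * (neg_entropy d1 x - neg_entropy d1 x')\<bar> \<le> (real d1 + real d2) / (\<delta> * \<eta>) * vec_dist x x'"
      by (intro reg[OF neg_entropy_lipschitz[OF x x' \<delta>]]) auto
    moreover have "reg_loss \<eta> d1 d2 M x y - reg_loss \<eta> d1 d2 M x' y
        = (bilin x M y - bilin x' M y) + 1 / \<eta> * (neg_entropy d1 x - neg_entropy d1 x')"
      by (simp add: reg_loss_def right_diff_distrib)
    ultimately show ?thesis unfolding distrib_right by linarith
  qed
  show "?Q y'" if y': "y' \<in> S2"
  proof -
    note yd' = prob_simplexD[OF trunc_simplexD(1)[OF y']]
    have "bilin x M y - bilin x M y' = A $$ (i, j) / (p $ i * q $ j) * x $ i * (y $ j - y' $ j)"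
      unfolding M_bilin[OF x y] M_bilin[OF x y'] by (simp add: algebra_simps diff_divide_distrib)
    then have "\<bar>bilin x M y - bilin x M y'\<bar> \<le> 1 / \<delta>\<^sup>2 * vec_dist y y'"
      using prod[of "x $ i" "y $ j - y' $ j" "vec_dist y y'"] xd ij abs_diff_le_vec_dist[of j y' y] yd'(1) by simp
    moreover have "\<bar>1 / \<eta> * (neg_entropy d2 y - neg_entropy d2 y')\<bar> \<le> (real d1 + real d2) / (\<delta> * \<eta>) * vec_dist y y'"
      by (intro reg[OF neg_entropy_lipschitz[OF y y' \<delta>]]) auto
    moreover have "reg_loss \<eta> d1 d2 M x y - reg_loss \<eta> d1 d2 M x y'
        = (bilin x M y - bilin x M y') - 1 / \<eta> * (neg_entropy d2 y - neg_entropy d2 y')"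
      by (simp add: reg_loss_def right_diff_distrib)
    ultimately show ?thesis unfolding distrib_right by linarith
  qed
qed

end

subsection \<open>Concentration of the estimates\<close>

lemma pmf_vec_pmf:
  assumes "x \<in> prob_simplex d"
  shows "pmf (vec_pmf x) i = (if i < d then x $ i else 0)"
proof -
  note xd = prob_simplexD[OF assms]
  have "(\<integral>\<^sup>+ i. ennreal (if i < d then x $ i else 0) \<partial>count_space UNIV) = (\<Sum>i<d. ennreal (if i < d then x $ i else 0))"
    by (intro nn_integral_count_space') auto
  also have "\<dots> = ennreal (\<Sum>i<d. if i < d then x $ i else 0)"
    using xd(3) by (intro sum_ennreal) auto
  also have "(\<Sum>i<d. if i < d then x $ i else 0) = (\<Sum>i<d. x $ i)" by (intro sum.cong) auto
  finally show ?thesis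
    unfolding vec_pmf_def using xd by (subst pmf_embed_pmf) auto
qed

lemma set_vec_pmf_subset:
  assumes "x \<in> prob_simplex d"
  shows "set_pmf (vec_pmf x) \<subseteq> {..<d}"
  using pmf_vec_pmf[OF assms] by (auto simp: set_pmf_iff split: if_splits)

lemma expectation_pair_vec_pmf:
  fixes f :: "nat \<times> nat \<Rightarrow> real"
  assumes "x \<in> prob_simplex d1" "y \<in> prob_simplex d2"
  shows "measure_pmf.expectation (pair_pmf (vec_pmf x) (vec_pmf y)) f
    = (\<Sum>k<d1. \<Sum>l<d2. x $ k * y $ l * f (k, l))"
proof -
  have "measure_pmf.expectation (pair_pmf (vec_pmf x) (vec_pmf y)) f
      = (\<Sum>a\<in>{..<d1} \<times> {..<d2}. f a * pmf (pair_pmf (vec_pmf x) (vec_pmf y)) a)"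
    using set_vec_pmf_subset[OF assms(1)] set_vec_pmf_subset[OF assms(2)]
    by (intro integral_measure_pmf_real) auto
  also have "\<dots> = (\<Sum>a\<in>{..<d1} \<times> {..<d2}. x $ fst a * y $ snd a * f (fst a, snd a))"
    using assms by (intro sum.cong) (auto simp: pmf_pair pmf_vec_pmf)
  also have "\<dots> = (\<Sum>k<d1. \<Sum>l<d2. x $ k * y $ l * f (k, l))"
    by (simp add: sum.cartesian_product case_prod_unfold)
  finally show ?thesis .
qed

text \<open>The tower rule: average over the next action with the history frozen, then over the
  history. Finite supports settle integrability.\<close>

lemma expectation_bind_append:
  fixes f :: "'a list \<Rightarrow> real"
  assumes "finite (set_pmf p)" "\<And>h. h \<in> set_pmf p \<Longrightarrow> finite (set_pmf (q h))"
  shows "measure_pmf.expectation (bind_pmf p (\<lambda>h. map_pmf (\<lambda>a. h @ [a]) (q h))) f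
    = measure_pmf.expectation p (\<lambda>h. measure_pmf.expectation (q h) (\<lambda>a. f (h @ [a])))"
proof -
  have "measure_pmf.expectation (bind_pmf p (\<lambda>h. map_pmf (\<lambda>a. h @ [a]) (q h))) f
      = (\<Sum>h\<in>set_pmf p. pmf p h *\<^sub>R measure_pmf.expectation (map_pmf (\<lambda>a. h @ [a]) (q h)) f)"
    using assms by (intro pmf_expectation_bind) auto
  also have "\<dots> = measure_pmf.expectation p (\<lambda>h. measure_pmf.expectation (q h) (\<lambda>a. f (h @ [a])))"
    using assms(1) by (subst integral_measure_pmf[of "set_pmf p"]) auto
  finally show ?thesis .
qed

section \<open>Support of the play\<close>

lemma play_pmf_support:
  assumes "\<And>h. h \<in> histories d1 d2 T \<Longrightarrow> X h \<in> prob_simplex d1 \<and> Y h \<in> prob_simplex d2"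
    and "t \<le> T" "h \<in> set_pmf (play_pmf X Y t)"
  shows "length h = t \<and> set h \<subseteq> {..<d1} \<times> {..<d2}"
  using assms(2,3)
proof (induction t arbitrary: h)
  case 0
  then show ?case by simp
next
  case (Suc t)
  then obtain g a where g: "g \<in> set_pmf (play_pmf X Y t)" and h: "h = g @ [a]"
    and a: "a \<in> set_pmf (pair_pmf (vec_pmf (X g)) (vec_pmf (Y g)))"
    by auto
  have len: "length g = t" "set g \<subseteq> {..<d1} \<times> {..<d2}" using Suc.IH[OF _ g] Suc.prems by auto
  then have "g \<in> histories d1 d2 T" using Suc.prems by (simp add: histories_def)
  then have "X g \<in> prob_simplex d1" "Y g \<in> prob_simplex d2" using assms(1) by auto
  then have "a \<in> {..<d1} \<times> {..<d2}"
    using a set_vec_pmf_subset[of "X g" d1] set_vec_pmf_subset[of "Y g" d2] by auto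
  with len h show ?case by simp
qed

lemma finite_set_play_pmf:
  assumes "\<And>h. h \<in> histories d1 d2 T \<Longrightarrow> X h \<in> prob_simplex d1 \<and> Y h \<in> prob_simplex d2"
    and "t \<le> T"
  shows "finite (set_pmf (play_pmf X Y t))"
proof (rule finite_subset)
  show "set_pmf (play_pmf X Y t) \<subseteq> {h. set h \<subseteq> {..<d1} \<times> {..<d2} \<and> length h = t}"
    using play_pmf_support[of d1 d2 T X Y t, OF assms] by auto
  show "finite {h. set h \<subseteq> {..<d1} \<times> {..<d2} \<and> length h = t}"
    by (intro finite_lists_length_eq) auto
qed

text \<open>\<open>m\<close> stands for the error accumulated before the round. The estimate is
  unbiased, so the cross term averages to zero and only the variance of one importance-weighted
  entry is added.\<close>

lemma est_mat_second_moment_step: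
  assumes p: "p \<in> trunc_simplex d1 \<delta>" and q: "q \<in> trunc_simplex d2 \<delta>" and \<delta>: "\<delta> > 0"
    and ij: "i < d1" "j < d2" and A: "\<bar>A $$ (i, j)\<bar> \<le> 1"
  defines "\<xi> \<equiv> \<lambda>a. est_mat d1 d2 A p q a $$ (i, j) - A $$ (i, j)"
  shows "measure_pmf.expectation (pair_pmf (vec_pmf p) (vec_pmf q)) (\<lambda>a. (m + \<xi> a)\<^sup>2) \<le> m\<^sup>2 + 1 / \<delta>\<^sup>2"
proof -
  note p' = trunc_simplexD(1)[OF p] and q' = trunc_simplexD(1)[OF q]
  define w where "w = p $ i * q $ j"
  define b where "b = A $$ (i, j)"
  have w: "w > 0" "\<delta>\<^sup>2 \<le> w"
    unfolding w_def power2_eq_square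
    using trunc_simplexD(2)[OF p ij(1)] trunc_simplexD(2)[OF q ij(2)] \<delta>
    by (auto intro!: mult_mono mult_pos_pos)
  have tot: "(\<Sum>k<d1. \<Sum>l<d2. p $ k * q $ l) = 1"
    using prob_simplexD(4)[OF p'] prob_simplexD(4)[OF q'] sum_product[of "($) p" "{..<d1}" "($) q" "{..<d2}"] by simp
  \<comment> \<open>Each pair first contributes as if the estimated entry were 0. The pair
    \<open>(i, j)\<close> is then corrected by w ((m - b + b/w)^2 - (m - b)^2), which simplifies to
    the second summand.\<close>
  have split: "p $ k * q $ l * (m + \<xi> (k, l))\<^sup>2 = (m - b)\<^sup>2 * (p $ k * q $ l)
      + (if l = j then if k = i then 2 * (m - b) * b + b\<^sup>2 / w else 0 else 0)" for k l
    using w(1) ij unfolding \<xi>_def b_def w_def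
    by (auto simp: est_mat_index power2_eq_square field_simps)
  have "measure_pmf.expectation (pair_pmf (vec_pmf p) (vec_pmf q)) (\<lambda>a. (m + \<xi> a)\<^sup>2)
      = (\<Sum>k<d1. \<Sum>l<d2. p $ k * q $ l * (m + \<xi> (k, l))\<^sup>2)"
    by (rule expectation_pair_vec_pmf[OF p' q'])
  also have "\<dots> = (m - b)\<^sup>2 * (\<Sum>k<d1. \<Sum>l<d2. p $ k * q $ l)
      + (\<Sum>k<d1. \<Sum>l<d2. if l = j then if k = i then 2 * (m - b) * b + b\<^sup>2 / w else 0 else 0)"
    unfolding split sum.distrib sum_distrib_left ..
  also have "\<dots> = (m - b)\<^sup>2 + (2 * (m - b) * b + b\<^sup>2 / w)"
    using ij by (simp add: tot)
  also have "\<dots> = m\<^sup>2 - b\<^sup>2 + b\<^sup>2 / w" by (simp add: power2_eq_square algebra_simps)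
  also have "b\<^sup>2 / w \<le> 1 / \<delta>\<^sup>2"
    using A w \<delta> by (intro frac_le) (auto simp: b_def abs_square_le_1)
  finally show ?thesis using zero_le_power2[of b] by linarith
qed

text \<open>Orthogonality of martingale increments. The payoff matrix and both iterates are
  functions of the history, hence constants once it is frozen; this is what admits an adaptive
  adversary.\<close>

lemma second_moment_est_error:
  assumes \<delta>: "\<delta> > 0" and bA: "bounded_adversary d1 d2 T A"
    and XY: "\<And>h. h \<in> histories d1 d2 T \<Longrightarrow> X h \<in> trunc_simplex d1 \<delta> \<and> Y h \<in> trunc_simplex d2 \<delta>"
    and ij: "i < d1" "j < d2" and t: "t \<le> T"
  defines "\<xi> \<equiv> \<lambda>h a. est_mat d1 d2 (A h) (X h) (Y h) a $$ (i, j) - A h $$ (i, j)"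
  shows "measure_pmf.expectation (play_pmf X Y t) (\<lambda>h. (\<Sum>s<t. \<xi> (take s h) (h ! s))\<^sup>2) \<le> real t / \<delta>\<^sup>2"
  using t
proof (induction t)
  case 0
  then show ?case by simp
next
  case (Suc t)
  have XY': "X h \<in> prob_simplex d1 \<and> Y h \<in> prob_simplex d2" if "h \<in> histories d1 d2 T" for h
    using XY[OF that] trunc_simplexD(1) by blast
  let ?q = "\<lambda>h. pair_pmf (vec_pmf (X h)) (vec_pmf (Y h))"
  let ?S = "\<lambda>h. \<Sum>s<t. \<xi> (take s h) (h ! s)"
  have supp: "length h = t" "h \<in> histories d1 d2 T" if "h \<in> set_pmf (play_pmf X Y t)" for h
    using play_pmf_support[of d1 d2 T X Y t h, OF XY' _ that] Suc.prems by (auto simp: histories_def)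
  have fin: "finite (set_pmf (play_pmf X Y t))"
    by (rule finite_set_play_pmf[OF XY']) (use Suc.prems in auto)
  have finq: "finite (set_pmf (?q h))" if "h \<in> set_pmf (play_pmf X Y t)" for h
    using XY'[OF supp(2)[OF that]] set_vec_pmf_subset[of "X h" d1] set_vec_pmf_subset[of "Y h" d2]
    by (auto intro!: finite_cartesian_product intro: finite_subset)
  have "measure_pmf.expectation (play_pmf X Y (Suc t)) (\<lambda>h. (\<Sum>s<Suc t. \<xi> (take s h) (h ! s))\<^sup>2)
      = measure_pmf.expectation (play_pmf X Y t) (\<lambda>h. measure_pmf.expectation (?q h)
          (\<lambda>a. (\<Sum>s<Suc t. \<xi> (take s (h @ [a])) ((h @ [a]) ! s))\<^sup>2))"
    unfolding play_pmf.simps by (rule expectation_bind_append[OF fin finq])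
  also have "\<dots> \<le> measure_pmf.expectation (play_pmf X Y t) (\<lambda>h. (?S h)\<^sup>2 + 1 / \<delta>\<^sup>2)"
  proof (rule integral_mono_AE)
    show "AE h in measure_pmf (play_pmf X Y t). measure_pmf.expectation (?q h)
        (\<lambda>a. (\<Sum>s<Suc t. \<xi> (take s (h @ [a])) ((h @ [a]) ! s))\<^sup>2) \<le> (?S h)\<^sup>2 + 1 / \<delta>\<^sup>2"
    proof (rule AE_pmfI)
      fix h assume h: "h \<in> set_pmf (play_pmf X Y t)"
      \<comment> \<open>Since \<open>h\<close> has length \<open>t\<close>, appending
        \<open>a\<close> leaves the first \<open>t\<close> increments unchanged, and the new one has
        exactly \<open>h\<close> as its past.\<close>
      have eq: "(\<Sum>s<Suc t. \<xi> (take s (h @ [a])) ((h @ [a]) ! s)) = ?S h + \<xi> h a" for a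
        using supp(1)[OF h] by (simp add: nth_append)
      have "\<bar>A h $$ (i, j)\<bar> \<le> 1"
        using bA supp(2)[OF h] ij unfolding bounded_adversary_def by (auto simp: abs_le_iff)
      then show "measure_pmf.expectation (?q h)
        (\<lambda>a. (\<Sum>s<Suc t. \<xi> (take s (h @ [a])) ((h @ [a]) ! s))\<^sup>2) \<le> (?S h)\<^sup>2 + 1 / \<delta>\<^sup>2"
        unfolding eq unfolding \<xi>_def
        using XY[OF supp(2)[OF h]] \<delta> ij by (intro est_mat_second_moment_step) auto
    qed
  qed (auto intro: integrable_measure_pmf_finite fin)
  also have "\<dots> = measure_pmf.expectation (play_pmf X Y t) (\<lambda>h. (?S h)\<^sup>2) + 1 / \<delta>\<^sup>2"
    by (subst Bochner_Integration.integral_add) (auto intro: integrable_measure_pmf_finite fin)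
  also have "\<dots> \<le> real (Suc t) / \<delta>\<^sup>2"
    using Suc by (simp add: add_divide_distrib)
  finally show ?case .
qed

subsection \<open>Regret along a play and in expectation\<close>

lemma bilin_unit_vec:
  assumes "A \<in> carrier_mat d1 d2" "i < d1" "j < d2"
  shows "bilin (unit_vec d1 i) A (unit_vec d2 j) = A $$ (i, j)"
proof -
  have "bilin (unit_vec d1 i) A (unit_vec d2 j)
      = (\<Sum>k<d1. \<Sum>l<d2. if l = j then if k = i then A $$ (i, j) else 0 else 0)"
    using assms by (simp add: bilin_eq_bilin_sum[of _ d1 _ d2] bilin_sum_def if_distrib cong: if_cong)
      (intro sum.cong, auto)
  also have "\<dots> = A $$ (i, j)" using assms by simp
  finally show ?thesis .
qed

text \<open>Trades an absolute value for a square, whose mean is under control, at a price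
  \<open>c\<close> that is fixed only at the very end.\<close>

lemma abs_le_quadratic:
  fixes s c :: real
  assumes "c > 0"
  shows "\<bar>s\<bar> \<le> c + s\<^sup>2 / c"
proof -
  have "c * \<bar>s\<bar> \<le> c\<^sup>2 + s\<^sup>2"
  proof -
    have "0 \<le> (c - \<bar>s\<bar>)\<^sup>2" "0 \<le> c * \<bar>s\<bar>" using assms by auto
    then show ?thesis unfolding power2_diff power2_abs by linarith
  qed
  then show ?thesis using assms by (simp add: field_simps power2_eq_square)
qed

lemma bandit_iterates_trunc_simplex:
  assumes "bandit_OMG_RFTL \<eta> \<delta> d1 d2 T A X Y" "h \<in> histories d1 d2 T"
  shows "X h \<in> trunc_simplex d1 \<delta> \<and> Y h \<in> trunc_simplex d2 \<delta>"
proof (cases "h = []")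
  case False
  then show ?thesis
    using assms unfolding bandit_OMG_RFTL_def is_argmin_max_def is_argmax_min_def is_arg_min_def is_arg_max_def
    by blast
qed (use assms in \<open>auto simp: bandit_OMG_RFTL_def\<close>)

text \<open>Each inequality moves the strategy of one player only, the one who must enter the
  truncated simplex; the other player's strategy is already admissible in the larger set.
  \<open>c\<close> bounds the entries, so it converts l1 distance into payoff.\<close>

lemma minimax_trunc_simplex_diff:
  assumes W: "\<And>i j. i < d1 \<Longrightarrow> j < d2 \<Longrightarrow> \<bar>W i j\<bar> \<le> c" and c: "0 \<le> c"
    and \<delta>: "0 \<le> \<delta>" "real d1 * \<delta> \<le> 1" "real d2 * \<delta> \<le> 1"
    and ne: "prob_simplex d1 \<noteq> {}" "prob_simplex d2 \<noteq> {}"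
  shows "\<bar>minimax (trunc_simplex d1 \<delta>) (trunc_simplex d2 \<delta>) (bilin_sum d1 d2 W)
    - minimax (prob_simplex d1) (prob_simplex d2) (bilin_sum d1 d2 W)\<bar> \<le> 2 * (real d1 + real d2) * \<delta> * c"
proof -
  let ?P1 = "prob_simplex d1" and ?P2 = "prob_simplex d2"
  let ?S1 = "trunc_simplex d1 \<delta>" and ?S2 = "trunc_simplex d2 \<delta>" and ?f = "bilin_sum d1 d2 W"
  have bP: "bounded_payoff ?P1 ?P2 ?f"
    unfolding bounded_payoff_def using abs_bilin_sum_simplex_le[of d1 d2 W c, OF W] by blast
  have sub: "?S1 \<subseteq> ?P1" "?S2 \<subseteq> ?P2" using trunc_simplexD(1) by blast+
  then have bS: "bounded_payoff ?S1 ?S2 ?f"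
    using bP unfolding bounded_payoff_def by (meson subsetD)
  have neS: "?S1 \<noteq> {}" "?S2 \<noteq> {}"
    using ne ex_trunc_simplex_near[OF _ \<delta>(1,2)] ex_trunc_simplex_near[OF _ \<delta>(1,3)] by blast+
  have le: "c * (2 * real d * \<delta>) \<le> 2 * (real d1 + real d2) * \<delta> * c" if "real d \<le> real d1 + real d2" for d
  proof -
    have "real d * (2 * \<delta> * c) \<le> (real d1 + real d2) * (2 * \<delta> * c)"
      using that \<delta>(1) c by (intro mult_right_mono) auto
    then show ?thesis by (simp add: mult_ac)
  qed
  have "\<exists>x\<in>?S1. \<forall>y\<in>?S2. \<exists>y'\<in>?P2. ?f x y \<le> ?f x' y' + 2 * (real d1 + real d2) * \<delta> * c" if x': "x' \<in> ?P1" for x'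
  proof -
    obtain x where x: "x \<in> ?S1" "(\<Sum>i<d1. \<bar>x $ i - x' $ i\<bar>) \<le> 2 * real d1 * \<delta>"
      using ex_trunc_simplex_near[OF x' \<delta>(1,2)] by blast
    have "?f x y \<le> ?f x' y + 2 * (real d1 + real d2) * \<delta> * c" if y: "y \<in> ?S2" for y
    proof -
      have "\<bar>?f x y - ?f x' y\<bar> \<le> c * (\<Sum>i<d1. \<bar>x $ i - x' $ i\<bar>)"
        using bilin_sum_lipschitz[of d1 d2 W c x x' y y, OF W] x(1) x' y sub by auto
      also have "\<dots> \<le> c * (2 * real d1 * \<delta>)" using x(2) c by (intro mult_left_mono)
      finally show ?thesis using le[of d1] by simp
    qed
    with x(1) sub show ?thesis by blast
  qed
  then have 1: "minimax ?S1 ?S2 ?f \<le> minimax ?P1 ?P2 ?f + 2 * (real d1 + real d2) * \<delta> * c"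
    by (rule minimax_mono[OF bS bP neS(2) ne(1)])
  have "\<exists>x\<in>?P1. \<forall>y\<in>?P2. \<exists>y'\<in>?S2. ?f x y \<le> ?f x' y' + 2 * (real d1 + real d2) * \<delta> * c" if x': "x' \<in> ?S1" for x'
  proof (rule bexI[of _ x'], rule ballI)
    show "x' \<in> ?P1" using x' sub by auto
    fix y assume y: "y \<in> ?P2"
    obtain y' where y': "y' \<in> ?S2" "(\<Sum>i<d2. \<bar>y' $ i - y $ i\<bar>) \<le> 2 * real d2 * \<delta>"
      using ex_trunc_simplex_near[OF y \<delta>(1,3)] by blast
    have "\<bar>?f x' y' - ?f x' y\<bar> \<le> c * (\<Sum>i<d2. \<bar>y' $ i - y $ i\<bar>)"
      using bilin_sum_lipschitz[of d1 d2 W c x' x' y' y, OF W] y'(1) x' y sub by auto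
    also have "\<dots> \<le> c * (2 * real d2 * \<delta>)" using y'(2) c by (intro mult_left_mono)
    finally have "?f x' y \<le> ?f x' y' + 2 * (real d1 + real d2) * \<delta> * c" using le[of d2] by simp
    with y'(1) show "\<exists>y'\<in>?S2. ?f x' y \<le> ?f x' y' + 2 * (real d1 + real d2) * \<delta> * c" by blast
  qed
  then have 2: "minimax ?P1 ?P2 ?f \<le> minimax ?S1 ?S2 ?f + 2 * (real d1 + real d2) * \<delta> * c"
    by (rule minimax_mono[OF bP bS ne(2) neS(1)])
  show ?thesis using 1 2 by simp
qed

text \<open>Holds for every individual play, with no probability involved. The quality of the
  estimates survives as the sum of squared entry errors, the only part that has to be averaged
  later.\<close>

lemma pathwise_regret:
  assumes \<delta>: "\<delta> > 0" "real d1 * \<delta> \<le> 1" "real d2 * \<delta> \<le> 1" and \<eta>: "\<eta> > 0"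
    and T: "T \<ge> 1" and c: "c > 0"
    and bA: "bounded_adversary d1 d2 T A" and alg: "bandit_OMG_RFTL \<eta> \<delta> d1 d2 T A X Y"
    and h: "length h = T" "set h \<subseteq> {..<d1} \<times> {..<d2}"
  defines "G \<equiv> 1 / \<delta>\<^sup>2 + (real d1 + real d2) / (\<delta> * \<eta>)"
  defines "\<xi> \<equiv> \<lambda>i j h a. est_mat d1 d2 (A h) (X h) (Y h) a $$ (i, j) - A h $$ (i, j)"
  shows "\<bar>(\<Sum>t<T. bilin (unit_vec d1 (fst (h ! t))) (A (take t h)) (unit_vec d2 (snd (h ! t))))
      - minimax (prob_simplex d1) (prob_simplex d2) (\<lambda>x y. \<Sum>t<T. bilin x (A (take t h)) y)\<bar>
    \<le> 2 * G + G\<^sup>2 * \<eta> * harm (T - 1) + 2 * (real T / \<eta>) * (real d1 + real d2)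
      + 2 * (real d1 + real d2) * \<delta> * real T
      + c + (\<Sum>i<d1. \<Sum>j<d2. (\<Sum>t<T. \<xi> i j (take t h) (h ! t))\<^sup>2) / c"
proof -
  define S1 S2 where "S1 = trunc_simplex d1 \<delta>" and "S2 = trunc_simplex d2 \<delta>"
  define D where "D = real d1 + real d2"
  define x y a where "x t = X (take t h)" and "y t = Y (take t h)" and "a t = A (take t h)" for t
  define M where "M t = est_mat d1 d2 (a t) (x t) (y t) (h ! t)" for t
  define L where "L t = reg_loss \<eta> d1 d2 (M t)" for t
  have hist: "take t h \<in> histories d1 d2 T" if "t < T" for t
    using that h set_take_subset[of t h] by (auto simp: histories_def)
  have xy: "x t \<in> S1" "y t \<in> S2" if "t < T" for t
    using bandit_iterates_trunc_simplex[OF alg hist[OF that]] by (auto simp: x_def y_def S1_def S2_def)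
  have a_carrier: "a t \<in> carrier_mat d1 d2" and a_le: "\<And>i j. i < d1 \<Longrightarrow> j < d2 \<Longrightarrow> \<bar>a t $$ (i, j)\<bar> \<le> 1"
    if "t < T" for t
    using bA hist[OF that] unfolding bounded_adversary_def by (auto simp: a_def abs_le_iff)
  have ht: "fst (h ! t) < d1" "snd (h ! t) < d2" if "t < T" for t
  proof -
    have "h ! t \<in> {..<d1} \<times> {..<d2}" using nth_mem[of t h] h that by blast
    then show "fst (h ! t) < d1" "snd (h ! t) < d2" by auto
  qed
  have D1: "d1 \<ge> 1" "d2 \<ge> 1" using ht[of 0] T by auto
  have ne: "S1 \<noteq> {}" "S2 \<noteq> {}" using xy[of 0] T by auto
  have neP: "prob_simplex d1 \<noteq> {}" "prob_simplex d2 \<noteq> {}"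
    using ne trunc_simplexD(1) by (auto simp: S1_def S2_def)
  note cv = convex_trunc_simplex[of d1 \<delta>, folded S1_def] convex_trunc_simplex[of d2 \<delta>, folded S2_def]
  have G: "G \<ge> 0" using \<delta> \<eta> by (simp add: G_def)

  have L_facts: "bounded_payoff S1 S2 (L t)"
      "\<And>v. v \<in> S2 \<Longrightarrow> strongly_convex S1 (1 / \<eta>) (\<lambda>u. L t u v)"
      "\<And>u. u \<in> S1 \<Longrightarrow> strongly_convex S2 (1 / \<eta>) (\<lambda>v. - L t u v)"
      "\<And>u u' v. u \<in> S1 \<Longrightarrow> u' \<in> S1 \<Longrightarrow> v \<in> S2 \<Longrightarrow> \<bar>L t u v - L t u' v\<bar> \<le> G * vec_dist u u'"
      "\<And>u v v'. u \<in> S1 \<Longrightarrow> v \<in> S2 \<Longrightarrow> v' \<in> S2 \<Longrightarrow> \<bar>L t u v - L t u v'\<bar> \<le> G * vec_dist v v'"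
      if t: "t < T" for t
  proof -
    obtain i j where ij: "h ! t = (i, j)" by fastforce
    note pre = xy[OF t, unfolded S1_def S2_def] \<delta>(1) \<eta> ht[OF t, unfolded ij fst_conv snd_conv]
      a_le[OF t ht[OF t, unfolded ij fst_conv snd_conv]]
    show "bounded_payoff S1 S2 (L t)"
      "\<And>v. v \<in> S2 \<Longrightarrow> strongly_convex S1 (1 / \<eta>) (\<lambda>u. L t u v)"
      "\<And>u. u \<in> S1 \<Longrightarrow> strongly_convex S2 (1 / \<eta>) (\<lambda>v. - L t u v)"
      "\<And>u u' v. u \<in> S1 \<Longrightarrow> u' \<in> S1 \<Longrightarrow> v \<in> S2 \<Longrightarrow> \<bar>L t u v - L t u' v\<bar> \<le> G * vec_dist u u'"
      "\<And>u v v'. u \<in> S1 \<Longrightarrow> v \<in> S2 \<Longrightarrow> v' \<in> S2 \<Longrightarrow> \<bar>L t u v - L t u v'\<bar> \<le> G * vec_dist v v'"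
      unfolding L_def M_def ij S1_def S2_def G_def
      using bounded_payoff_reg_loss[OF pre] reg_loss_strongly_convex[OF pre]
        reg_loss_strongly_concave[OF pre] reg_loss_lipschitz[OF pre] by auto
  qed

  have saddle: "saddle_point S1 S2 (\<lambda>u v. \<Sum>s<t. L s u v) (x t) (y t)" if t: "0 < t" "t < T" for t
  proof -
    define F where "F u v = (\<Sum>s<t. L s u v)" for u v
    have "cum_loss \<eta> d1 d2 A X Y (take t h) = F"
    proof (intro ext)
      fix u v
      have "length (take t h) = t" using t h by simp
      then show "cum_loss \<eta> d1 d2 A X Y (take t h) u v = F u v"
        unfolding cum_loss_def F_def L_def M_def a_def x_def y_def
        by (intro sum.cong) (auto simp: min_def)
    qed
    moreover have "take t h \<noteq> []" using t h by auto
    ultimately have arg: "is_argmin_max S1 S2 F (x t)" "is_argmax_min S1 S2 F (y t)"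
      using alg hist[OF t(2)] unfolding bandit_OMG_RFTL_def S1_def S2_def x_def y_def by auto
    have bp: "bounded_payoff S1 S2 F"
      unfolding F_def using L_facts(1) t by (intro bounded_payoff_sum) auto
    have "(INF u\<in>S1. SUP v\<in>S2. F u v) \<le> (SUP v\<in>S2. INF u\<in>S1. F u v)"
    proof (rule minimax_strongly_concave[OF bp ne cv])
      show "0 < real t * (1 / \<eta>)" using t \<eta> by simp
      fix v assume v: "v \<in> S2"
      have "strongly_convex S1 (real t * (1 / \<eta>)) (\<lambda>u. F u v)"
        unfolding F_def using strongly_convex_sum[of "{..<t}" S1 "1 / \<eta>" "\<lambda>s u. L s u v"] L_facts(2)[OF _ v] t by simp
      then show "strongly_convex S1 0 (\<lambda>u. F u v)"
        by (rule strongly_convex_mono) (use \<eta> in auto)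
    next
      fix u assume u: "u \<in> S1"
      show "strongly_convex S2 (real t * (1 / \<eta>)) (\<lambda>v. - F u v)"
        using strongly_convex_sum[of "{..<t}" S2 "1 / \<eta>" "\<lambda>s v. - L s u v"] L_facts(3)[OF _ u] t
        by (simp add: F_def sum_negf)
    next
      fix u v v' assume uv: "u \<in> S1" "v \<in> S2" "v' \<in> S2"
      have "F u v - F u v' = (\<Sum>s<t. L s u v - L s u v')" by (simp add: F_def sum_subtractf)
      also have "\<dots> \<le> (\<Sum>s<t. G * vec_dist v v')"
        using L_facts(5)[OF _ uv] t by (intro sum_mono) (auto intro: order_trans[OF abs_ge_self])
      finally show "F u v - F u v' \<le> real t * G * vec_dist v v'" by simp
    qed
    from saddle_pointI[OF bp ne arg this] show ?thesis unfolding F_def .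
  qed

  \<comment> \<open>From \<open>V0\<close> to \<open>V3\<close> one ingredient changes at a time:
    drop the regulariser, replace the estimates by the true matrices, remove the truncation.\<close>
  define V0 where "V0 = minimax S1 S2 (\<lambda>u v. \<Sum>t<T. L t u v)"
  define V1 where "V1 = minimax S1 S2 (\<lambda>u v. \<Sum>t<T. bilin u (M t) v)"
  define V2 where "V2 = minimax S1 S2 (\<lambda>u v. \<Sum>t<T. bilin u (a t) v)"
  define V3 where "V3 = minimax (prob_simplex d1) (prob_simplex d2) (\<lambda>u v. \<Sum>t<T. bilin u (a t) v)"

  \<comment> \<open>\<open>Suc (T - 1)\<close> is \<open>T\<close> because \<open>T \<ge> 1\<close>,
    and 2 bounds the Euclidean diameter of both strategy sets.\<close>
  have "\<bar>(\<Sum>t<Suc (T - 1). L t (x t) (y t)) - minimax S1 S2 (\<lambda>u v. \<Sum>t<Suc (T - 1). L t u v)\<bar>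
      \<le> G * 2 + G\<^sup>2 / (1 / \<eta>) * harm (T - 1)"
  proof (rule saddle_regret[OF cv])
    show "L t (x t) (y t) - L t u (y t) \<le> G * vec_dist u (x t)" if "t < T" "u \<in> S1" for t u
      using L_facts(4)[OF that(1) that(2) xy[OF that(1)]] by linarith
    show "L t (x t) v - L t (x t) (y t) \<le> G * vec_dist v (y t)" if "t < T" "v \<in> S2" for t v
      using L_facts(5)[OF that(1) xy(1)[OF that(1)] that(2) xy(2)[OF that(1)]] by linarith
    show "vec_dist u v \<le> 2" if "u \<in> S1" "v \<in> S1" for u v
      using that vec_dist_simplex_le trunc_simplexD(1) unfolding S1_def by blast
    show "vec_dist u v \<le> 2" if "u \<in> S2" "v \<in> S2" for u v
      using that vec_dist_simplex_le trunc_simplexD(1) unfolding S2_def by blast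
  qed (use \<eta> G L_facts(1-3) xy saddle T in auto)
  then have R0: "\<bar>(\<Sum>t<T. L t (x t) (y t)) - V0\<bar> \<le> 2 * G + G\<^sup>2 * \<eta> * harm (T - 1)"
    using T by (simp add: V0_def)

  have reg: "\<bar>L t u v - bilin u (M t) v\<bar> \<le> D / \<eta>" if "u \<in> S1" "v \<in> S2" for t u v
  proof -
    have "\<bar>neg_entropy d1 u - neg_entropy d2 v\<bar> \<le> D"
      using abs_neg_entropy_le[OF that(1)[unfolded S1_def] \<delta>(1) D1(1)]
        abs_neg_entropy_le[OF that(2)[unfolded S2_def] \<delta>(1) D1(2)] by (simp add: D_def)
    then have "1 / \<eta> * \<bar>neg_entropy d1 u - neg_entropy d2 v\<bar> \<le> 1 / \<eta> * D"
      using \<eta> by (intro mult_left_mono) auto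
    moreover have "L t u v - bilin u (M t) v = 1 / \<eta> * (neg_entropy d1 u - neg_entropy d2 v)"
      by (simp add: L_def reg_loss_def right_diff_distrib)
    ultimately show ?thesis using \<eta> by (simp add: abs_mult)
  qed
  have sum_reg: "\<bar>(\<Sum>t<T. L t (u t) (v t)) - (\<Sum>t<T. bilin (u t) (M t) (v t))\<bar> \<le> real T / \<eta> * D"
    if "\<And>t. t < T \<Longrightarrow> u t \<in> S1 \<and> v t \<in> S2" for u v
  proof -
    have "\<bar>\<Sum>t<T. L t (u t) (v t) - bilin (u t) (M t) (v t)\<bar> \<le> (\<Sum>t<T. D / \<eta>)"
      using that reg by (intro order_trans[OF sum_abs] sum_mono) auto
    then show ?thesis by (simp add: sum_subtractf)
  qed

  have est: "bilin u (M t) v = bilin_sum d1 d2 (\<lambda>i j. M t $$ (i, j)) u v" if "u \<in> S1" "v \<in> S2" for t u v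
    using that prob_simplexD(2)[OF trunc_simplexD(1)] unfolding S1_def S2_def M_def
    by (intro bilin_eq_bilin_sum est_mat_carrier) auto
  have act: "bilin u (a t) v = bilin_sum d1 d2 (\<lambda>i j. a t $$ (i, j)) u v"
    if "u \<in> prob_simplex d1" "v \<in> prob_simplex d2" "t < T" for t u v
    using that prob_simplexD(2) a_carrier by (intro bilin_eq_bilin_sum) auto
  define W where "W i j = (\<Sum>t<T. a t $$ (i, j))" for i j
  have sum_act: "(\<Sum>t<T. bilin u (a t) v) = bilin_sum d1 d2 W u v"
    if "u \<in> prob_simplex d1" "v \<in> prob_simplex d2" for u v
    unfolding W_def bilin_sum_sum[symmetric] using act that by (intro sum.cong) auto
  have W_le: "\<bar>W i j\<bar> \<le> real T" if "i < d1" "j < d2" for i j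
  proof -
    have "\<bar>W i j\<bar> \<le> (\<Sum>t<T. 1)"
      unfolding W_def using a_le that by (intro order_trans[OF sum_abs] sum_mono) auto
    then show ?thesis by simp
  qed

  have played: "(\<Sum>t<T. bilin (x t) (M t) (y t))
      = (\<Sum>t<T. bilin (unit_vec d1 (fst (h ! t))) (a t) (unit_vec d2 (snd (h ! t))))"
  proof (intro sum.cong refl)
    fix t assume "t \<in> {..<T}"
    then have t: "t < T" by simp
    obtain i j where ij: "h ! t = (i, j)" by fastforce
    have "i < d1" "j < d2" using ht[OF t] ij by auto
    moreover have "x t $ i > 0" "y t $ j > 0"
      using xy[OF t] \<delta>(1) calculation trunc_simplexD(2) unfolding S1_def S2_def
      by (meson less_le_trans)+
    moreover have "x t \<in> carrier_vec d1" "y t \<in> carrier_vec d2"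
      using xy[OF t] prob_simplexD(2) trunc_simplexD(1) unfolding S1_def S2_def by blast+
    ultimately show "bilin (x t) (M t) (y t) = bilin (unit_vec d1 (fst (h ! t))) (a t) (unit_vec d2 (snd (h ! t)))"
      unfolding M_def ij using a_carrier[OF t] by (simp add: bilin_est_mat bilin_unit_vec)
  qed

  \<comment> \<open>A single \<open>Z\<close> dominates every entry error, since the square of one
    entry is at most the sum over all entries. No maximum over entries has to be handled in
    expectation.\<close>
  define Z where "Z = c + (\<Sum>i<d1. \<Sum>j<d2. (\<Sum>t<T. \<xi> i j (take t h) (h ! t))\<^sup>2) / c"
  define E where "E i j = (\<Sum>t<T. M t $$ (i, j) - a t $$ (i, j))" for i j
  have E_eq: "E i j = (\<Sum>t<T. \<xi> i j (take t h) (h ! t))" for i j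
    unfolding E_def \<xi>_def M_def a_def x_def y_def ..
  have E_le: "\<bar>E i j\<bar> \<le> Z" if "i < d1" "j < d2" for i j
  proof -
    have "(E i j)\<^sup>2 \<le> (\<Sum>j<d2. (E i j)\<^sup>2)" using that by (intro member_le_sum) auto
    also have "\<dots> \<le> (\<Sum>i<d1. \<Sum>j<d2. (E i j)\<^sup>2)"
      using that by (intro member_le_sum[of i _ "\<lambda>i. \<Sum>j<d2. (E i j)\<^sup>2"] sum_nonneg) auto
    finally have "(E i j)\<^sup>2 / c \<le> (\<Sum>i<d1. \<Sum>j<d2. (E i j)\<^sup>2) / c"
      using c by (intro divide_right_mono) auto
    with abs_le_quadratic[OF c, of "E i j"] show ?thesis unfolding Z_def E_eq by linarith
  qed

  have bpL: "bounded_payoff S1 S2 (\<lambda>u v. \<Sum>t<T. L t u v)"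
    using L_facts(1) by (intro bounded_payoff_sum) auto
  have bpW: "bounded_payoff S1 S2 (\<lambda>u v. \<Sum>t<T. bilin u (a t) v)"
    unfolding bounded_payoff_def
  proof (intro exI ballI)
    fix u v assume "u \<in> S1" "v \<in> S2"
    then have uv: "u \<in> prob_simplex d1" "v \<in> prob_simplex d2" using trunc_simplexD(1) by (auto simp: S1_def S2_def)
    show "\<bar>\<Sum>t<T. bilin u (a t) v\<bar> \<le> real T"
      unfolding sum_act[OF uv] using W_le uv by (rule abs_bilin_sum_simplex_le)
  qed
  have diffMa: "\<bar>(\<Sum>t<T. bilin u (M t) v) - (\<Sum>t<T. bilin u (a t) v)\<bar> \<le> Z" if uv: "u \<in> S1" "v \<in> S2" for u v
  proof -
    have uv': "u \<in> prob_simplex d1" "v \<in> prob_simplex d2" using uv trunc_simplexD(1) by (auto simp: S1_def S2_def)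
    have "(\<Sum>t<T. bilin u (M t) v) - (\<Sum>t<T. bilin u (a t) v) = bilin_sum d1 d2 E u v"
      unfolding sum_act[OF uv'] W_def E_def est[OF uv] bilin_sum_sum bilin_sum_diff sum_subtractf ..
    then show ?thesis using abs_bilin_sum_simplex_le[OF E_le uv'] by simp
  qed
  have bpM: "bounded_payoff S1 S2 (\<lambda>u v. \<Sum>t<T. bilin u (M t) v)"
  proof -
    obtain B where B: "\<And>u v. u \<in> S1 \<Longrightarrow> v \<in> S2 \<Longrightarrow> \<bar>\<Sum>t<T. bilin u (a t) v\<bar> \<le> B"
      using bpW unfolding bounded_payoff_def by blast
    have "\<bar>\<Sum>t<T. bilin u (M t) v\<bar> \<le> B + Z" if "u \<in> S1" "v \<in> S2" for u v
      using diffMa[OF that] B[OF that] by linarith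
    then show ?thesis unfolding bounded_payoff_def by blast
  qed

  have R1: "\<bar>V0 - V1\<bar> \<le> real T / \<eta> * D"
    unfolding V0_def V1_def by (rule minimax_diff_le[OF bpL bpM ne]) (rule sum_reg, auto)
  have R2: "\<bar>V1 - V2\<bar> \<le> Z"
    unfolding V1_def V2_def by (rule minimax_diff_le[OF bpM bpW ne diffMa])
  have cong: "minimax P Q f = minimax P Q g" if "\<And>u v. u \<in> P \<Longrightarrow> v \<in> Q \<Longrightarrow> f u v = g u v"
    for P :: "real vec set" and Q :: "real vec set" and f g
    unfolding minimax_def using that by (auto intro!: INF_cong SUP_cong)
  have "V2 = minimax S1 S2 (bilin_sum d1 d2 W)"
    unfolding V2_def using trunc_simplexD(1) by (intro cong sum_act) (auto simp: S1_def S2_def)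
  moreover have "V3 = minimax (prob_simplex d1) (prob_simplex d2) (bilin_sum d1 d2 W)"
    unfolding V3_def by (intro cong sum_act)
  ultimately have R3: "\<bar>V2 - V3\<bar> \<le> 2 * D * \<delta> * real T"
    unfolding S1_def S2_def D_def using minimax_trunc_simplex_diff[OF W_le _ _ \<delta>(2,3) neP] \<delta>(1) by simp
  have R4: "\<bar>(\<Sum>t<T. L t (x t) (y t)) - (\<Sum>t<T. bilin (x t) (M t) (y t))\<bar> \<le> real T / \<eta> * D"
    using xy by (intro sum_reg) auto
  \<comment> \<open>The regulariser is paid for twice, once in the minimax value (\<open>R1\<close>)
    and once along the iterates (\<open>R4\<close>).\<close>
  have "\<bar>(\<Sum>t<T. bilin (x t) (M t) (y t)) - V3\<bar>
      \<le> 2 * G + G\<^sup>2 * \<eta> * harm (T - 1) + 2 * (real T / \<eta> * D) + 2 * D * \<delta> * real T + Z"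
    using R0 R1 R2 R3 R4 by linarith
  then show ?thesis
    unfolding played unfolding V3_def a_def Z_def D_def by (simp add: mult.assoc)
qed

text \<open>The pathwise bound is on an absolute value, so averaging it controls even the mean of
  \<open>\<bar>f h\<bar>\<close>. Each of the \<open>d1 * d2\<close> squared entry errors then
  contributes at most T/\<delta>^2.\<close>

lemma expected_regret:
  assumes \<delta>: "\<delta> > 0" "real d1 * \<delta> \<le> 1" "real d2 * \<delta> \<le> 1" and \<eta>: "\<eta> > 0"
    and T: "T \<ge> 1" and c: "c > 0"
    and bA: "bounded_adversary d1 d2 T A" and alg: "bandit_OMG_RFTL \<eta> \<delta> d1 d2 T A X Y"
  defines "G \<equiv> 1 / \<delta>\<^sup>2 + (real d1 + real d2) / (\<delta> * \<eta>)"
  shows "\<bar>measure_pmf.expectation (play_pmf X Y T) (\<lambda>h.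
        (\<Sum>t<T. bilin (unit_vec d1 (fst (h ! t))) (A (take t h)) (unit_vec d2 (snd (h ! t))))
        - minimax (prob_simplex d1) (prob_simplex d2) (\<lambda>x y. \<Sum>t<T. bilin x (A (take t h)) y))\<bar>
    \<le> 2 * G + G\<^sup>2 * \<eta> * harm (T - 1) + 2 * (real T / \<eta>) * (real d1 + real d2)
      + 2 * (real d1 + real d2) * \<delta> * real T + c + real d1 * real d2 * real T / (\<delta>\<^sup>2 * c)"
proof -
  define p where "p = play_pmf X Y T"
  define f where "f h = (\<Sum>t<T. bilin (unit_vec d1 (fst (h ! t))) (A (take t h)) (unit_vec d2 (snd (h ! t))))
        - minimax (prob_simplex d1) (prob_simplex d2) (\<lambda>x y. \<Sum>t<T. bilin x (A (take t h)) y)" for h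
  define \<xi> where "\<xi> i j h a = est_mat d1 d2 (A h) (X h) (Y h) a $$ (i, j) - A h $$ (i, j)" for i j h a
  define S where "S i j h = (\<Sum>t<T. \<xi> i j (take t h) (h ! t))\<^sup>2" for i j and h :: history
  define K where "K = 2 * G + G\<^sup>2 * \<eta> * harm (T - 1) + 2 * (real T / \<eta>) * (real d1 + real d2)
      + 2 * (real d1 + real d2) * \<delta> * real T + c"
  have XY: "X h \<in> trunc_simplex d1 \<delta> \<and> Y h \<in> trunc_simplex d2 \<delta>" if "h \<in> histories d1 d2 T" for h
    using bandit_iterates_trunc_simplex[OF alg that] .
  then have XY': "X h \<in> prob_simplex d1 \<and> Y h \<in> prob_simplex d2" if "h \<in> histories d1 d2 T" for h
    using that trunc_simplexD(1) by blast
  have fin: "finite (set_pmf p)" unfolding p_def by (rule finite_set_play_pmf[OF XY']) auto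
  have int [simp]: "integrable (measure_pmf p) g" for g :: "history \<Rightarrow> real"
    by (rule integrable_measure_pmf_finite[OF fin])
  have "\<bar>measure_pmf.expectation p f\<bar> \<le> measure_pmf.expectation p (\<lambda>h. \<bar>f h\<bar>)"
    by (rule integral_abs_bound)
  also have "\<dots> \<le> measure_pmf.expectation p (\<lambda>h. K + (\<Sum>i<d1. \<Sum>j<d2. S i j h) / c)"
  proof (rule integral_mono_AE)
    show "AE h in measure_pmf p. \<bar>f h\<bar> \<le> K + (\<Sum>i<d1. \<Sum>j<d2. S i j h) / c"
    proof (rule AE_pmfI)
      fix h assume "h \<in> set_pmf p"
      then have "length h = T" "set h \<subseteq> {..<d1} \<times> {..<d2}"
        using play_pmf_support[of d1 d2 T X Y T h, OF XY'] by (auto simp: p_def)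
      from pathwise_regret[OF \<delta> \<eta> T c bA alg this]
      show "\<bar>f h\<bar> \<le> K + (\<Sum>i<d1. \<Sum>j<d2. S i j h) / c"
        unfolding f_def K_def S_def \<xi>_def G_def .
    qed
  qed auto
  also have "\<dots> = K + (\<Sum>i<d1. \<Sum>j<d2. measure_pmf.expectation p (S i j)) / c"
    by (simp add: measure_pmf.prob_space)
  also have "\<dots> \<le> K + (\<Sum>i<d1. \<Sum>j<d2. real T / \<delta>\<^sup>2) / c"
  proof -
    have "measure_pmf.expectation p (S i j) \<le> real T / \<delta>\<^sup>2" if "i < d1" "j < d2" for i j
      unfolding p_def S_def \<xi>_def using second_moment_est_error[OF \<delta>(1) bA XY that order_refl] .
    then show ?thesis using c by (intro add_left_mono divide_right_mono sum_mono) auto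
  qed
  also have "(\<Sum>i<d1. \<Sum>j<d2. real T / \<delta>\<^sup>2) / c = real d1 * real d2 * real T / (\<delta>\<^sup>2 * c)"
    by simp
  finally show ?thesis unfolding p_def f_def K_def .
qed

theorem theorem5:
  shows "\<exists>C::real. \<forall>(d1::nat) (d2::nat) (T::nat) (\<delta>::real) (\<eta>::real)
      (A::adversary) (X::strategy) (Y::strategy).
    d1 \<ge> 1 \<longrightarrow> d2 \<ge> 1 \<longrightarrow> T \<ge> 1 \<longrightarrow>
    \<delta> = 1 / real T powr (1/6) \<longrightarrow> \<eta> = real T powr (1/6) \<longrightarrow>
    \<delta> < min (1 / real d1) (1 / real d2) \<longrightarrow>
    bounded_adversary d1 d2 T A \<longrightarrow>
    bandit_OMG_RFTL \<eta> \<delta> d1 d2 T A X Y \<longrightarrow>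
    \<bar>measure_pmf.expectation (play_pmf X Y T) (\<lambda>h.
        (\<Sum>t<T. bilin (unit_vec d1 (fst (h ! t))) (A (take t h)) (unit_vec d2 (snd (h ! t))))
        - minimax (prob_simplex d1) (prob_simplex d2) (\<lambda>x y. \<Sum>t<T. bilin x (A (take t h)) y))\<bar>
    \<le> C * ((real d1 + real d2) * ln (real T) * real T powr (5/6))"
proof (intro exI[of _ 30] allI impI)
  fix d1 d2 T :: nat and \<delta> \<eta> :: real and A :: adversary and X Y :: strategy
  assume d: "d1 \<ge> 1" "d2 \<ge> 1" and T: "T \<ge> 1"
    and \<delta>: "\<delta> = 1 / real T powr (1/6)" and \<eta>: "\<eta> = real T powr (1/6)"
    and small: "\<delta> < min (1 / real d1) (1 / real d2)"
    and bA: "bounded_adversary d1 d2 T A" and alg: "bandit_OMG_RFTL \<eta> \<delta> d1 d2 T A X Y"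
  \<comment> \<open>In terms of \<open>r\<close> all quantities become integer powers: T = r^6,
    \<delta> = 1/r, \<eta> = r, and the target rate is r^5.\<close>
  define r where "r = real T powr (1/6)"
  define s where "s = real d1 + real d2"
  have r0: "r > 0" using T by (simp add: r_def)
  have r6: "real T = r ^ 6"
    using T by (simp add: r_def powr_realpow[symmetric] powr_powr)
  have r5: "real T powr (5/6) = r ^ 5"
    using T by (simp add: r_def powr_realpow[symmetric] powr_powr)
  have \<delta>r: "\<delta> = 1 / r" and \<eta>r: "\<eta> = r" using \<delta> \<eta> by (simp_all add: r_def)
  have dr: "real d1 < r" "real d2 < r"
    using small d r0 by (auto simp: \<delta>r field_simps)
  have r1: "r \<ge> 1" using dr d by linarith
  have s2: "s \<ge> 2" "s \<le> 2 * r" using d dr by (auto simp: s_def)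
  \<comment> \<open>At \<open>T = 1\<close> the claimed bound would be 0, but then \<delta> = 1
    violates the strict condition on \<delta>. From \<open>T \<ge> 2\<close> the logarithm is at
    least 1/2 and can absorb constants.\<close>
  have "T \<noteq> 1" using dr d by (auto simp: r_def)
  then have T2: "T \<ge> 2" using T by simp
  have "ln (1 / 2 :: real) \<le> 1 / 2 - 1" by (rule ln_le_minus_one) simp
  then have "1 / 2 \<le> ln (2 :: real)" by (simp add: ln_div)
  also have "\<dots> \<le> ln (real T)" using T2 by simp
  finally have l: "1 / 2 \<le> ln (real T)" .
  define l where "l = ln (real T)"
  have sl: "1 \<le> s * l" "s \<le> 2 * (s * l)" "l \<le> s * l / 2"
    using mult_mono[OF s2(1) l] mult_left_mono[OF l, of s] mult_right_mono[OF s2(1), of l] s2(1) l by (auto simp: l_def)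
  define G where "G = 1 / \<delta>\<^sup>2 + (real d1 + real d2) / (\<delta> * \<eta>)"
  have "G = r\<^sup>2 + s" using r0 by (simp add: G_def \<delta>r \<eta>r s_def power_divide)
  moreover have "r \<le> r\<^sup>2" using r1 by (simp add: power2_eq_square)
  ultimately have G: "0 \<le> G" "G \<le> 3 * r\<^sup>2" using s2 by auto
  have r25: "r\<^sup>2 \<le> r ^ 5" using r1 by (intro power_increasing) auto
  have H: "harm (T - 1) \<le> 1 + l" "0 \<le> (harm (T - 1) :: real)"
  proof -
    have "harm (T - 1) \<le> (harm (Suc (T - 1)) :: real)" by (rule harm_mono) simp
    also have "\<dots> \<le> 1 + l" using harm_le_ln[of "T - 1"] T by (simp add: l_def)
    finally show "harm (T - 1) \<le> 1 + l" .
  qed (rule harm_nonneg)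
  have "G\<^sup>2 * r \<le> (3 * r\<^sup>2)\<^sup>2 * r" using G r0 by (intro mult_right_mono power_mono) auto
  also have "\<dots> = 9 * r ^ 5" by (simp add: power2_eq_square eval_nat_numeral)
  finally have "G\<^sup>2 * r \<le> 9 * r ^ 5" .
  then have "G\<^sup>2 * r * harm (T - 1) \<le> 9 * r ^ 5 * (1 + l)"
    by (rule mult_mono[OF _ H(1) _ H(2)]) (use r0 in simp)
  moreover have "2 * (real T / r) * s = 2 * s * r ^ 5" "2 * s * (1 / r) * real T = 2 * s * r ^ 5"
    using r0 by (simp_all add: r6 eval_nat_numeral)
  \<comment> \<open>The estimation term for the choice \<open>c = r ^ 5\<close>. It equals d1 d2
    r^3, and both dimensions are below \<open>r\<close>.\<close>
  moreover have "real d1 * real d2 * real T / ((1 / r)\<^sup>2 * r ^ 5) \<le> r ^ 5"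
  proof -
    have "real d1 * real d2 * real T / ((1 / r)\<^sup>2 * r ^ 5) = real d1 * real d2 * r ^ 3"
      using r0 by (simp add: r6 field_simps eval_nat_numeral)
    also have "\<dots> \<le> r * r * r ^ 3" using dr r0 by (intro mult_mono) auto
    finally show ?thesis by (simp add: eval_nat_numeral)
  qed
  moreover have "real d1 * \<delta> \<le> 1" "real d2 * \<delta> \<le> 1" "\<delta> > 0" "\<eta> > 0" "r ^ 5 > 0"
    using dr r0 by (auto simp: \<delta>r \<eta>r field_simps)
  note expected_regret[OF this(3,1,2,4) T this(5) bA alg, folded G_def s_def, unfolded \<delta>r \<eta>r]
  ultimately have "\<bar>measure_pmf.expectation (play_pmf X Y T) (\<lambda>h.
        (\<Sum>t<T. bilin (unit_vec d1 (fst (h ! t))) (A (take t h)) (unit_vec d2 (snd (h ! t))))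
        - minimax (prob_simplex d1) (prob_simplex d2) (\<lambda>x y. \<Sum>t<T. bilin x (A (take t h)) y))\<bar>
    \<le> 6 * r ^ 5 + 9 * r ^ 5 * (1 + l) + 2 * s * r ^ 5 + 2 * s * r ^ 5 + r ^ 5 + r ^ 5"
    using G(2) r25 by linarith
  also have "\<dots> = (17 + 4 * s + 9 * l) * r ^ 5" by (simp add: algebra_simps)
  \<comment> \<open>By \<open>sl\<close> the three summands are at most 17, 8 and 4.5 times
    \<open>s * l\<close>, in total 29.5, whence the constant 30.\<close>
  also have "\<dots> \<le> (30 * (s * l)) * r ^ 5"
    using sl r0 by (intro mult_right_mono) auto
  finally show "\<bar>measure_pmf.expectation (play_pmf X Y T) (\<lambda>h.
        (\<Sum>t<T. bilin (unit_vec d1 (fst (h ! t))) (A (take t h)) (unit_vec d2 (snd (h ! t))))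
        - minimax (prob_simplex d1) (prob_simplex d2) (\<lambda>x y. \<Sum>t<T. bilin x (A (take t h)) y))\<bar>
    \<le> 30 * ((real d1 + real d2) * ln (real T) * real T powr (5/6))"
    unfolding r5 s_def l_def by (simp add: mult.assoc)
qed

end
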